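(* Let $\Omega$ be a bounded domain in $\mathbb{C}^d$ satisfying properties (1) and (2) below, and let $\Phi:\Omega\to\mathbb{C}^d$ be holomorphic on $\overline\Omega$ with $\Phi(\Omega)$ having an interior point. Then for every $\varepsilon>0$ there is a domain $\widehat\Omega$ satisfying properties (1) and (2) with $\widehat\Omega\,\Delta\,\Omega\subseteq O(\partial\Omega,\varepsilon)$ such that $\mathcal{V}^*(\Phi,\widehat\Omega)$ is trivial, i.e. equals $\mathbb{C}I$ (here $\Phi$ is regarded as its holomorphic extension to a neighborhood of $\overline\Omega$ containing $\widehat\Omega$).
   Context: "Holomorphic on $\overline\Omega$" means holomorphic on an open neighborhood of $\overline\Omega$. $\widehat\Omega\,\Delta\,\Omega$ is the symmetric difference and $O(\partial\Omega,\varepsilon)$ the $\varepsilon$-neighborhood of $\partial\Omega$. For a domain $D$ and $\Phi=(\phi_1,\dots,\phi_d)$ bounded holomorphic on $D$, $\mathcal{V}^*(\Phi,D)$ is the von Neumann algebra of all bounded operators on the Bergman space $L^2_a(D)$ commuting with each $M_{\phi_j,D}f=\phi_jf$ and its adjoint. Property (1): the boundary has Lebesgue measure zero. Property (2): for every boundary point $\zeta$ and every open neighborhood $\mathcal O$ of $\zeta$, $\mathcal O$ minus the domain contains an open ball. *)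

theory Defs
  imports "HOL-Analysis.Analysis"
begin

type_synonym 'n cvec = "complex ^ 'n"

definition holo_on :: "('n::finite) cvec set \<Rightarrow> ('n cvec \<Rightarrow> complex) \<Rightarrow> bool" where
  "holo_on U f \<longleftrightarrow> (\<forall>z\<in>U. \<exists>L. (f has_derivative L) (at z) \<and> (\<forall>c v. L (c *s v) = c * L v))"

definition holo_map_on :: "('n::finite) cvec set \<Rightarrow> ('n cvec \<Rightarrow> 'm::finite cvec) \<Rightarrow> bool" where
  "holo_map_on U F \<longleftrightarrow> (\<forall>j. holo_on U (\<lambda>z. F z $ j))"

definition is_domain :: "('n::finite) cvec set \<Rightarrow> bool" where
  "is_domain D \<longleftrightarrow> open D \<and> connected D \<and> D \<noteq> {}"

definition prop1 :: "('n::finite) cvec set \<Rightarrow> bool" where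
  "prop1 D \<longleftrightarrow> frontier D \<in> null_sets lebesgue"

definition prop2 :: "('n::finite) cvec set \<Rightarrow> bool" where
  "prop2 D \<longleftrightarrow> (\<forall>\<zeta>\<in>frontier D. \<forall>N. open N \<and> \<zeta> \<in> N \<longrightarrow>
                    (\<exists>c r. r > 0 \<and> ball c r \<subseteq> N - D))"

definition nbhd :: "('n::finite) cvec set \<Rightarrow> real \<Rightarrow> 'n cvec set" where
  "nbhd S \<epsilon> = {z. \<exists>w\<in>S. dist z w < \<epsilon>}"

text \<open>Bergman space: holomorphic, square-integrable functions on D
  (functions are identified when they agree on D).\<close>
definition bergman :: "('n::finite) cvec set \<Rightarrow> ('n cvec \<Rightarrow> complex) set" where
  "bergman D = {f. holo_on D f \<and> set_integrable lebesgue D (\<lambda>z. (cmod (f z))\<^sup>2)}"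

definition berg_ip :: "('n::finite) cvec set \<Rightarrow> ('n cvec \<Rightarrow> complex) \<Rightarrow> ('n cvec \<Rightarrow> complex) \<Rightarrow> complex" where
  "berg_ip D f g = (LINT z:D|lebesgue. f z * cnj (g z))"

definition berg_norm :: "('n::finite) cvec set \<Rightarrow> ('n cvec \<Rightarrow> complex) \<Rightarrow> real" where
  "berg_norm D f = sqrt (LINT z:D|lebesgue. (cmod (f z))\<^sup>2)"

type_synonym 'n op = "('n cvec \<Rightarrow> complex) \<Rightarrow> ('n cvec \<Rightarrow> complex)"

definition bdd_op :: "('n::finite) cvec set \<Rightarrow> 'n op \<Rightarrow> bool" where
  "bdd_op D T \<longleftrightarrow>
     (\<forall>f\<in>bergman D. T f \<in> bergman D) \<and>
     (\<forall>f\<in>bergman D. \<forall>g\<in>bergman D. \<forall>z\<in>D. T (\<lambda>w. f w + g w) z = T f z + T g z) \<and>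
     (\<forall>f\<in>bergman D. \<forall>c. \<forall>z\<in>D. T (\<lambda>w. c * f w) z = c * T f z) \<and>
     (\<exists>C. \<forall>f\<in>bergman D. berg_norm D (T f) \<le> C * berg_norm D f)"

definition is_adjoint :: "('n::finite) cvec set \<Rightarrow> 'n op \<Rightarrow> 'n op \<Rightarrow> bool" where
  "is_adjoint D T S \<longleftrightarrow> (\<forall>f\<in>bergman D. S f \<in> bergman D) \<and>
     (\<forall>f\<in>bergman D. \<forall>g\<in>bergman D. berg_ip D (T f) g = berg_ip D f (S g))"

definition mult_op :: "('n::finite cvec \<Rightarrow> complex) \<Rightarrow> 'n op" where
  "mult_op \<phi> f = (\<lambda>z. \<phi> z * f z)"

definition commute_on :: "('n::finite) cvec set \<Rightarrow> 'n op \<Rightarrow> 'n op \<Rightarrow> bool" where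
  "commute_on D T S \<longleftrightarrow> (\<forall>f\<in>bergman D. \<forall>z\<in>D. T (S f) z = S (T f) z)"

definition Vstar :: "('n::finite cvec \<Rightarrow> 'm::finite cvec) \<Rightarrow> 'n cvec set \<Rightarrow> 'n op set" where
  "Vstar \<Phi> D = {T. bdd_op D T \<and>
      (\<forall>j. commute_on D T (mult_op (\<lambda>z. \<Phi> z $ j)) \<and>
           (\<forall>S. is_adjoint D (mult_op (\<lambda>z. \<Phi> z $ j)) S \<longrightarrow> commute_on D T S))}"

definition Vstar_trivial :: "('n::finite cvec \<Rightarrow> 'm::finite cvec) \<Rightarrow> 'n cvec set \<Rightarrow> bool" where
  "Vstar_trivial \<Phi> D \<longleftrightarrow>
     (\<forall>T\<in>Vstar \<Phi> D. \<exists>c. \<forall>f\<in>bergman D. \<forall>z\<in>D. T f z = c * f z)"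

end

theory Submission
  imports Defs "HOL-Complex_Analysis.Conformal_Mappings"
begin

text \<open>
  If \<open>D\<close> contains a nonempty open set \<open>W\<close> on which \<open>\<Phi>\<close> is injective and whose points share their
  \<open>\<Phi>\<close>-fibre with no other point of \<open>D\<close>, then \<open>\<V>\<^sup>*(\<Phi>, D)\<close> is trivial: commuting with
  every \<open>M\<^sub>\<phi>\<close> and its adjoint makes all moments \<open>p(\<Phi>) cnj (q(\<Phi>))\<close> of \<open>T f - f cnj (T\<^sup>*1)\<close> vanish,
  so by Stone-Weierstrass its integral over every ball in \<open>W\<close> vanishes, hence \<open>T f = f cnj (T\<^sup>*1)\<close> on \<open>W\<close>;
  for \<open>f = 1\<close> the function \<open>cnj (T\<^sup>*1)\<close> is holomorphic, hence locally constant.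

  To create such a \<open>W\<close>, put \<open>\<psi> = Re \<Phi>\<^sub>j\<close> and attach to \<open>\<Omega>\<close> a thin tube around a segment leaving \<open>\<Omega>\<close> near
  a maximum point of \<open>\<psi>\<close> on the closure. The segment ends where \<open>\<psi>\<close> first reaches a value above this maximum,
  at a point where the Jacobian of \<open>\<Phi>\<close> does not vanish; \<open>W\<close> is a superlevel set of \<open>\<psi>\<close> near that end.
  Taking the interior of the closure restores property (2).
\<close>

section \<open>Holomorphic functions of several variables\<close>

text \<open>\<open>Vstar\<close> tests \<open>T\<close> only against those \<open>S\<close> that are
  adjoints of the multiplication operators, so its adjoint clause is empty until such an
  \<open>S\<close> is exhibited. Hence the Riesz representation and the completeness of the Bergman
  space; the latter rests on bounded point evaluation, and that on a mean value inequality obtained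
  by averaging over the rotations \<open>w \<mapsto> exp (\<i> * \<theta>) *s w\<close>. The moment
  identity is \<open><p(\<Phi>) T f, q(\<Phi>)> = <T (p(\<Phi>) f), q(\<Phi>)> = <p(\<Phi>) f,
  q(\<Phi>) T\<^sup>*1>\<close>. \<open>W\<close> is cut out by an inequality for
  \<open>\<psi>\<close>, and \<open>\<psi> z\<close> depends on \<open>\<Phi> z\<close> only; so
  \<open>W\<close> automatically contains every fibre that it meets. What remains is injectivity:
  the superlevel set has to shrink into a ball on which \<open>\<Phi>\<close> is injective. Ending
  the segment at a first hitting point achieves this, since the rest of the segment stays lower. The
  interior point of the image of \<open>\<Omega>\<close> acts twice: it keeps \<open>\<psi>\<close>
  from having a local maximum and, through Sard's theorem, the Jacobian from vanishing
  identically.\<close>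

lemma norm_cvec_scale: "norm (c *s (v::'n::finite cvec)) = cmod c * norm v"
  by (simp add: norm_vec_def norm_mult L2_set_right_distrib)

lemma bounded_linear_cvec_scale: "bounded_linear (\<lambda>t. t *s (v::'n::finite cvec))"
proof (rule bounded_linear_intro[where K="norm v"])
  fix x y :: complex and r :: real
  show "(x + y) *s v = x *s v + y *s v" by (simp add: vec_eq_iff algebra_simps)
  show "(r *\<^sub>R x) *s v = r *\<^sub>R (x *s v)" by (simp add: vec_eq_iff)
  show "norm (x *s v) \<le> norm x * norm v" by (simp add: norm_cvec_scale)
qed

lemma continuous_on_cvec_line: "continuous_on S (\<lambda>t. a + t *s (v::'n::finite cvec))"
  by (intro continuous_intros bounded_linear.continuous_on[OF bounded_linear_cvec_scale])

lemma open_cvec_line: "open U \<Longrightarrow> open {t. a + t *s (v::'n::finite cvec) \<in> U}"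
  using open_vimage[OF _ continuous_on_cvec_line[of UNIV a v]] by (simp add: vimage_def)

lemma convex_cvec_line:
  assumes "convex U" shows "convex {t. a + t *s (v::'n::finite cvec) \<in> U}"
proof (rule convexI)
  fix x y :: complex and u w :: real
  assume "x \<in> {t. a + t *s v \<in> U}" "y \<in> {t. a + t *s v \<in> U}" and uw: "0 \<le> u" "0 \<le> w" "u + w = 1"
  then have "u *\<^sub>R (a + x *s v) + w *\<^sub>R (a + y *s v) \<in> U"
    using assms by (auto simp: convex_def)
  also have "u *\<^sub>R (a + x *s v) + w *\<^sub>R (a + y *s v) = (u + w) *\<^sub>R a + (u *\<^sub>R x + w *\<^sub>R y) *s v"
    by (simp add: vec_eq_iff algebra_simps)
  finally show "u *\<^sub>R x + w *\<^sub>R y \<in> {t. a + t *s v \<in> U}" using uw by simp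
qed

section \<open>Holomorphy along complex lines\<close>

definition line_holo :: "('n::finite) cvec set \<Rightarrow> ('n cvec \<Rightarrow> complex) \<Rightarrow> bool" where
  "line_holo U f \<longleftrightarrow> (\<forall>a v. (\<lambda>t. f (a + t *s v)) holomorphic_on {t. a + t *s v \<in> U})"

text \<open>Where \<open>f\<close> has a complex linear Frechet derivative this is that derivative
  (\<open>dird_unique\<close>). It thus names the witness \<open>L\<close> hidden in
  \<open>holo_on\<close> and is at the same time a one-variable \<open>deriv\<close>.\<close>

definition dird :: "(('n::finite) cvec \<Rightarrow> complex) \<Rightarrow> 'n cvec \<Rightarrow> 'n cvec \<Rightarrow> complex" where
  "dird f z v = deriv (\<lambda>t. f (z + t *s v)) 0"

lemma has_field_derivative_line:
  assumes "(f has_derivative L) (at (a + t *s (v::'n::finite cvec)))" "\<And>c v. L (c *s v) = c * L v"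
  shows "((\<lambda>t. f (a + t *s v)) has_field_derivative L v) (at t)"
proof -
  have "((\<lambda>t. a + t *s v) has_derivative (\<lambda>t. t *s v)) (at t)"
    using has_derivative_add[OF has_derivative_const bounded_linear_imp_has_derivative[OF bounded_linear_cvec_scale]]
    by simp
  from has_derivative_compose[OF this assms(1)]
  have "((\<lambda>t. f (a + t *s v)) has_derivative (\<lambda>t. t * L v)) (at t)"
    using assms(2) by simp
  moreover have "(\<lambda>t. t * L v) = (*) (L v)" by (auto simp: mult.commute)
  ultimately show ?thesis by (simp add: has_field_derivative_def)
qed

lemma holo_on_imp_line_holo:
  assumes "holo_on U f" shows "line_holo U f"
  unfolding line_holo_def
proof (intro allI)
  fix a v
  show "(\<lambda>t. f (a + t *s v)) holomorphic_on {t. a + t *s v \<in> U}"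
    unfolding holomorphic_on_def field_differentiable_def
  proof
    fix t assume "t \<in> {t. a + t *s v \<in> U}"
    then obtain L where "(f has_derivative L) (at (a + t *s v))" "\<forall>c v. L (c *s v) = c * L v"
      using assms unfolding holo_on_def by auto
    then have "((\<lambda>t. f (a + t *s v)) has_field_derivative L v) (at t)"
      by (intro has_field_derivative_line) auto
    then show "\<exists>f'. ((\<lambda>t. f (a + t *s v)) has_field_derivative f') (at t within {t. a + t *s v \<in> U})"
      using DERIV_subset by blast
  qed
qed

lemma dird_unique:
  assumes "(f has_derivative L) (at z)" "\<And>c v. L (c *s v) = c * L v"
  shows "dird f z = L"
proof
  fix v
  show "dird f z v = L v"
    unfolding dird_def using has_field_derivative_line[of f L z 0 v] assms
    by (simp add: DERIV_imp_deriv)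
qed

lemma holo_on_has_derivative:
  assumes "holo_on U f" "z \<in> U"
  shows "(f has_derivative dird f z) (at z)" "dird f z (c *s v) = c * dird f z v"
  using assms dird_unique unfolding holo_on_def by metis+

lemma holo_on_subset: "holo_on U f \<Longrightarrow> V \<subseteq> U \<Longrightarrow> holo_on V f"
  by (auto simp: holo_on_def)

lemma holo_on_continuous_on: "holo_on U f \<Longrightarrow> continuous_on U f"
  by (meson continuous_at_imp_continuous_on has_derivative_continuous holo_on_has_derivative(1))

lemma holo_on_const [simp]: "holo_on U (\<lambda>_. c)"
  unfolding holo_on_def by (auto intro!: exI[of _ "\<lambda>_. 0"])

lemma holo_on_add:
  assumes "holo_on U f" "holo_on U g" shows "holo_on U (\<lambda>z. f z + g z)"
  unfolding holo_on_def
proof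
  fix z assume z: "z \<in> U"
  show "\<exists>L. ((\<lambda>z. f z + g z) has_derivative L) (at z) \<and> (\<forall>c v. L (c *s v) = c * L v)"
    using holo_on_has_derivative[OF assms(1) z] holo_on_has_derivative[OF assms(2) z]
    by (intro exI[of _ "\<lambda>v. dird f z v + dird g z v"] conjI has_derivative_add)
       (simp_all add: algebra_simps)
qed

lemma holo_on_mult:
  assumes "holo_on U f" "holo_on U g" shows "holo_on U (\<lambda>z. f z * g z)"
  unfolding holo_on_def
proof
  fix z assume z: "z \<in> U"
  show "\<exists>L. ((\<lambda>z. f z * g z) has_derivative L) (at z) \<and> (\<forall>c v. L (c *s v) = c * L v)"
    using holo_on_has_derivative[OF assms(1) z] holo_on_has_derivative[OF assms(2) z]
    by (intro exI[of _ "\<lambda>v. f z * dird g z v + dird f z v * g z"] conjI has_derivative_mult)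
       (simp_all add: algebra_simps)
qed

lemma holo_on_cmult: "holo_on U f \<Longrightarrow> holo_on U (\<lambda>z. c * f z)"
  by (intro holo_on_mult holo_on_const)

lemma holo_on_diff: "holo_on U f \<Longrightarrow> holo_on U g \<Longrightarrow> holo_on U (\<lambda>z. f z - g z)"
  using holo_on_add[of U f "\<lambda>z. (-1) * g z"] holo_on_cmult[of U g "-1"] by simp

lemma holo_on_translate:
  assumes "holo_on U f" "\<And>z. z \<in> V \<Longrightarrow> z + w \<in> U"
  shows "holo_on V (\<lambda>z. f (z + w))"
  unfolding holo_on_def
proof
  fix z assume "z \<in> V"
  then obtain L where L: "(f has_derivative L) (at (z + w))" "\<forall>c v. L (c *s v) = c * L v"
    using assms unfolding holo_on_def by meson
  have "((\<lambda>z. z + w) has_derivative (\<lambda>z. z)) (at z)"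
    by (auto intro!: derivative_eq_intros)
  from has_derivative_compose[OF this L(1)] L(2)
  show "\<exists>L. ((\<lambda>z. f (z + w)) has_derivative L) (at z) \<and> (\<forall>c v. L (c *s v) = c * L v)" by auto
qed

text \<open>Zeros propagate along complex lines. Near a limit point \<open>x\<close> of the interior
  \<open>Z\<close> of the zero set, any \<open>b\<close> in a small ball lies on a complex line
  through some \<open>a\<close> in \<open>Z\<close> and in the ball; the one-variable identity
  theorem on the convex slice of the ball gives \<open>f b = 0\<close>. So \<open>Z\<close> is open
  and closed in \<open>U\<close>.\<close>

lemma line_holo_identity:
  assumes f: "line_holo U f" and U: "open U" "connected U"
    and V: "open V" "V \<noteq> {}" "V \<subseteq> U" "\<And>z. z \<in> V \<Longrightarrow> f z = 0" and z: "z \<in> U"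
  shows "f z = 0"
proof -
  define Z where "Z = interior {z\<in>U. f z = 0}"
  have ZU: "Z \<subseteq> {z\<in>U. f z = 0}" unfolding Z_def by (rule interior_subset)
  have VZ: "V \<subseteq> Z" unfolding Z_def using V by (intro interior_maximal) auto
  have "closedin (top_of_set U) Z"
    unfolding closedin_limpt
  proof (intro conjI allI impI)
    show "Z \<subseteq> U" using ZU by auto
    fix x assume x: "x islimpt Z \<and> x \<in> U"
    then obtain r where r: "r > 0" "ball x r \<subseteq> U" using U open_contains_ball by metis
    obtain a where a: "a \<in> Z" "dist a x < r"
      using x r unfolding islimpt_approachable by metis
    have "f b = 0" if b: "b \<in> ball x r" for b
    proof -
      let ?S = "{t. a + t *s (b - a) \<in> ball x r}" and ?Y = "{t. a + t *s (b - a) \<in> Z \<inter> ball x r}"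
      have "(\<lambda>t. f (a + t *s (b - a))) holomorphic_on ?S"
      proof (rule holomorphic_on_subset)
        show "(\<lambda>t. f (a + t *s (b - a))) holomorphic_on {t. a + t *s (b - a) \<in> U}"
          using f unfolding line_holo_def by blast
      qed (use r in blast)
      moreover have "open ?Y" using open_cvec_line[of "Z \<inter> ball x r" a "b - a"] by (auto simp: Z_def)
      moreover have "?Y \<noteq> {}" using a by (auto simp: dist_commute intro!: exI[of _ 0])
      moreover have "open ?S" "connected ?S" "1 \<in> ?S"
        using open_cvec_line[of "ball x r" a "b - a"] convex_connected[OF convex_cvec_line[of "ball x r" a "b - a"]] b
        by auto
      moreover have "f (a + t *s (b - a)) = 0" if "t \<in> ?Y" for t using that ZU by auto
      ultimately have "f (a + 1 *s (b - a)) = 0"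
        by (intro analytic_continuation_open[of ?Y ?S "\<lambda>t. f (a + t *s (b - a))" "\<lambda>_. 0" 1]) auto
      then show ?thesis by simp
    qed
    then have "ball x r \<subseteq> Z" unfolding Z_def using r by (intro interior_maximal) auto
    then show "x \<in> Z" using r by auto
  qed
  moreover have "openin (top_of_set U) Z"
    using ZU by (auto simp: Z_def openin_open_eq[OF U(1)])
  ultimately have "Z = U" using U(2) V(2) VZ unfolding connected_clopen by auto
  then show ?thesis using ZU z by auto
qed

section \<open>Cauchy estimates, locally uniform limits and the maximum principle\<close>

text \<open>Cauchy's inequality for \<open>t \<mapsto> f (a + t *s h)\<close> on the disc of radius
  \<open>r / norm h\<close>. Only smaller closed discs fit into the open ball, so the bound is
  proved for \<open>\<rho> < r / norm h\<close> and passed to the limit.\<close>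

lemma dird_bound:
  assumes f: "holo_on (ball a r) f" "\<And>z. z \<in> ball a r \<Longrightarrow> cmod (f z) \<le> B" and "r > 0"
  shows "cmod (dird f a h) \<le> B / r * norm h"
proof (cases "h = 0")
  case True
  then show ?thesis using holo_on_has_derivative(2)[OF f(1), of a 0 0] \<open>r > 0\<close> by simp
next
  case False
  have "cmod (dird f a h) \<le> B / \<rho>" if \<rho>: "0 < \<rho>" "\<rho> < r / norm h" for \<rho>
  proof -
    have sub: "cball 0 \<rho> \<subseteq> {t. a + t *s h \<in> ball a r}"
    proof (clarsimp simp: dist_norm norm_cvec_scale)
      fix t assume "cmod t \<le> \<rho>"
      then have "cmod t < r / norm h" using \<rho> by simp
      then show "cmod t * norm h < r" using False by (simp add: pos_less_divide_eq)
    qed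
    have hol: "(\<lambda>t. f (a + t *s h)) holomorphic_on cball 0 \<rho>"
      using holo_on_imp_line_holo[OF f(1)] sub unfolding line_holo_def by (meson holomorphic_on_subset)
    have "norm ((deriv ^^ 1) (\<lambda>t. f (a + t *s h)) 0) \<le> fact 1 * B / \<rho> ^ 1"
    proof (rule Cauchy_inequality)
      show "(\<lambda>t. f (a + t *s h)) holomorphic_on ball 0 \<rho>"
        using hol holomorphic_on_subset ball_subset_cball by blast
      fix x assume "cmod (0 - x) = \<rho>"
      then have "x \<in> cball 0 \<rho>" by simp
      then show "cmod (f (a + x *s h)) \<le> B" using sub f(2) by blast
    qed (use hol \<rho> holomorphic_on_imp_continuous_on in auto)
    then show ?thesis by (simp add: dird_def)
  qed
  moreover have "B \<ge> 0" using f(2)[of a] \<open>r > 0\<close> by (auto intro: order_trans[OF norm_ge_zero])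
  moreover have "((\<lambda>\<rho>. B / \<rho>) \<longlongrightarrow> B / (r / norm h)) (at_left (r / norm h))"
    using False \<open>r > 0\<close> by (intro tendsto_intros) auto
  moreover have "\<forall>\<^sub>F \<rho> in at_left (r / norm h). 0 < \<rho> \<and> \<rho> < r / norm h"
    using False \<open>r > 0\<close> by (intro eventually_at_leftI[of 0]) auto
  ultimately have "cmod (dird f a h) \<le> B / (r / norm h)"
    by (intro tendsto_lowerbound[where F="at_left (r / norm h)"]) (auto elim: eventually_mono)
  then show ?thesis by simp
qed

lemma dird_diff:
  assumes "holo_on U f" "holo_on U g" "z \<in> U"
  shows "dird (\<lambda>z. f z - g z) z h = dird f z h - dird g z h"
proof -
  have "dird (\<lambda>z. f z - g z) z = (\<lambda>h. dird f z h - dird g z h)"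
    using assms by (intro dird_unique has_derivative_diff)
      (auto simp: algebra_simps holo_on_has_derivative)
  then show ?thesis by simp
qed

text \<open>Weierstrass' theorem at the centre of the ball. \<open>dird_bound\<close> for
  \<open>f m - f n\<close> turns uniform closeness of values into uniform closeness of derivatives,
  as \<open>has_derivative_sequence\<close> requires; complex linearity survives the pointwise limit
  of the derivatives.\<close>

lemma holo_uniform_limit_at:
  assumes f: "\<And>n. holo_on (ball a r) (f n)" and lim: "uniform_limit (ball a r) f g sequentially" and "r > 0"
  shows "\<exists>L. (g has_derivative L) (at a) \<and> (\<forall>c v. L (c *s v) = c * L v)"
proof -
  \<comment> \<open>Half the radius leaves room for a ball of radius \<open>r/2\<close> about each
    point, on which the Cauchy estimate is applied.\<close>
  let ?S = "ball a (r/2)"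
  have *: "\<exists>N. \<forall>m\<ge>N. \<forall>n\<ge>N. \<forall>x\<in>?S. \<forall>h. cmod (dird (f m) x h - dird (f n) x h) \<le> e * norm h" if "e > 0" for e
  proof -
    have "uniformly_Cauchy_on (ball a r) f"
      using lim uniformly_convergent_Cauchy uniformly_convergent_on_def by blast
    then obtain N where N: "\<And>x m n. x \<in> ball a r \<Longrightarrow> m \<ge> N \<Longrightarrow> n \<ge> N \<Longrightarrow> dist (f m x) (f n x) < e * (r/2)"
      unfolding uniformly_Cauchy_on_def using \<open>e > 0\<close> \<open>r > 0\<close>
      by (metis half_gt_zero mult_pos_pos)
    have "cmod (dird (f m) x h - dird (f n) x h) \<le> e * norm h" if mn: "m \<ge> N" "n \<ge> N" "x \<in> ?S" for m n x h
    proof -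
      have sub: "ball x (r/2) \<subseteq> ball a r"
        using mn by (intro ball_subset_ball_iff[THEN iffD2]) (auto simp: dist_commute field_simps)
      have "cmod (dird (\<lambda>z. f m z - f n z) x h) \<le> (e * (r/2)) / (r/2) * norm h"
      proof (rule dird_bound)
        show "holo_on (ball x (r/2)) (\<lambda>z. f m z - f n z)"
          using holo_on_subset[OF f sub] by (intro holo_on_diff)
        fix z assume "z \<in> ball x (r/2)"
        then show "cmod (f m z - f n z) \<le> e * (r/2)"
          using N[of z m n] mn sub by (force simp: dist_norm)
      qed (use \<open>r > 0\<close> in auto)
      moreover have "dird (\<lambda>z. f m z - f n z) x h = dird (f m) x h - dird (f n) x h"
        using mn \<open>r > 0\<close> by (intro dird_diff[OF f f]) auto
      ultimately show ?thesis using \<open>r > 0\<close> by simp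
    qed
    then show ?thesis by blast
  qed
  define g' where "g' x h = lim (\<lambda>n. dird (f n) x h)" for x h
  have conv: "(\<lambda>n. dird (f n) x h) \<longlonglongrightarrow> g' x h" if "x \<in> ?S" for x h
  proof -
    have "Cauchy (\<lambda>n. dird (f n) x h)"
    proof (rule CauchyI)
      fix e :: real assume "e > 0"
      then have "e / (norm h + 1) > 0" by (simp add: add_nonneg_pos)
      from *[OF this] obtain N where
        N: "\<forall>m\<ge>N. \<forall>n\<ge>N. \<forall>x\<in>?S. \<forall>h'. cmod (dird (f m) x h' - dird (f n) x h') \<le> e / (norm h + 1) * norm h'" ..
      have less: "e / (norm h + 1) * norm h < e"
        using \<open>e > 0\<close> by (simp add: divide_simps add_nonneg_pos)
      show "\<exists>M. \<forall>m\<ge>M. \<forall>n\<ge>M. norm (dird (f m) x h - dird (f n) x h) < e"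
      proof (intro exI[of _ N] allI impI)
        fix m n assume "N \<le> m" "N \<le> n"
        then have "cmod (dird (f m) x h - dird (f n) x h) \<le> e / (norm h + 1) * norm h"
          using N that by blast
        also note less
        finally show "cmod (dird (f m) x h - dird (f n) x h) < e" .
      qed
    qed
    then show ?thesis
      unfolding g'_def using Cauchy_convergent convergent_LIMSEQ_iff by blast
  qed
  have "\<exists>g2. \<forall>x\<in>?S. (\<lambda>n. f n x) \<longlonglongrightarrow> g2 x \<and> (g2 has_derivative g' x) (at x within ?S)"
  proof (rule has_derivative_sequence)
    show "((\<lambda>n. f n a) \<longlongrightarrow> g a) sequentially"
      using tendsto_uniform_limitI[OF lim] \<open>r > 0\<close> by simp
    fix n x assume "x \<in> ?S"
    then have "x \<in> ball a r" using \<open>r > 0\<close> by auto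
    then show "(f n has_derivative dird (f n) x) (at x within ?S)"
      using holo_on_has_derivative(1)[OF f] has_derivative_at_withinI by blast
  next
    fix e :: real assume "e > 0"
    from *[OF this] obtain N where
      N: "\<forall>m\<ge>N. \<forall>n\<ge>N. \<forall>x\<in>?S. \<forall>h. cmod (dird (f m) x h - dird (f n) x h) \<le> e * norm h" ..
    have "cmod (dird (f n) x h - g' x h) \<le> e * norm h" if "n \<ge> N" "x \<in> ?S" for n x h
    proof (rule tendsto_upperbound[where F=sequentially])
      show "(\<lambda>m. cmod (dird (f n) x h - dird (f m) x h)) \<longlonglongrightarrow> cmod (dird (f n) x h - g' x h)"
        by (intro tendsto_intros conv that)
      show "\<forall>\<^sub>F m in sequentially. cmod (dird (f n) x h - dird (f m) x h) \<le> e * norm h"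
        using N that unfolding eventually_sequentially by blast
    qed auto
    then show "\<forall>\<^sub>F n in sequentially. \<forall>x\<in>?S. \<forall>h. cmod (dird (f n) x h - g' x h) \<le> e * norm h"
      unfolding eventually_sequentially by blast
  qed (use \<open>r > 0\<close> in auto)
  then obtain g2 where g2: "\<And>x. x \<in> ?S \<Longrightarrow> (\<lambda>n. f n x) \<longlonglongrightarrow> g2 x"
    "\<And>x. x \<in> ?S \<Longrightarrow> (g2 has_derivative g' x) (at x within ?S)" by blast
  have aS: "a \<in> ?S" using \<open>r > 0\<close> by simp
  have eq: "g2 x = g x" if "x \<in> ?S" for x
  proof (rule LIMSEQ_unique[OF g2(1)[OF that]])
    show "(\<lambda>n. f n x) \<longlonglongrightarrow> g x" using tendsto_uniform_limitI[OF lim, of x] that \<open>r > 0\<close> by auto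
  qed
  have "(g2 has_derivative g' a) (at a)"
    using g2(2)[OF aS] at_within_open[OF aS open_ball] by simp
  then have "(g has_derivative g' a) (at a)"
    by (rule has_derivative_transform_within_open[OF _ open_ball aS]) (use eq in auto)
  moreover have "g' a (c *s v) = c * g' a v" for c v
  proof (rule LIMSEQ_unique[OF conv[OF aS]])
    have "(\<lambda>n. c * dird (f n) a v) \<longlonglongrightarrow> c * g' a v" by (intro tendsto_intros conv aS)
    then show "(\<lambda>n. dird (f n) a (c *s v)) \<longlonglongrightarrow> c * g' a v"
      using holo_on_has_derivative(2)[OF f, of a] \<open>r > 0\<close> by simp
  qed
  ultimately show ?thesis by blast
qed

text \<open>\<open>holo_on\<close> asks for a derivative at each point and says nothing about its
  dependence on the point. Difference quotients in direction \<open>v\<close> are holomorphic and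
  converge locally uniformly to the directional derivative, the error being controlled by a
  second-order Taylor bound.\<close>

lemma holo_on_dird:
  assumes U: "open U" and f: "holo_on U f"
  shows "holo_on U (\<lambda>z. dird f z v)"
  unfolding holo_on_def
proof
  fix a assume a: "a \<in> U"
  obtain R where R: "R > 0" "ball a R \<subseteq> U" "\<And>z. z \<in> ball a R \<Longrightarrow> cmod (f z) \<le> cmod (f a) + 1"
  proof -
    obtain r where r: "r > 0" "ball a r \<subseteq> U" using U a open_contains_ball by metis
    have "isCont f a" using holo_on_has_derivative(1)[OF f a] has_derivative_continuous by blast
    then obtain d where d: "d > 0" "\<And>x. dist x a < d \<Longrightarrow> dist (f x) (f a) < 1"
      unfolding continuous_at_eps_delta by (metis zero_less_one)
    show ?thesis
    proof
      show "min r d > 0" "ball a (min r d) \<subseteq> U" using r d by auto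
      fix z assume "z \<in> ball a (min r d)"
      then have "cmod (f z - f a) < 1" using d(2)[of z] by (simp add: dist_norm norm_minus_commute)
      then show "cmod (f z) \<le> cmod (f a) + 1" using norm_triangle_sub[of "f z" "f a"] by simp
    qed
  qed
  define B where "B = cmod (f a) + 1"
  \<comment> \<open>Small enough that \<open>x + t *s v\<close> stays in \<open>ball a R\<close> for
    \<open>x\<close> in the half ball and \<open>cmod t \<le> 2 * \<rho>\<close>: the Taylor
    expansion uses one \<open>\<rho>\<close>, the Cauchy discs about its points another. The
    \<open>+ 1\<close> covers \<open>v = 0\<close>.\<close>
  define \<rho> where "\<rho> = R / 2 / (norm v + 1) / 2"
  have \<rho>: "\<rho> > 0" unfolding \<rho>_def using R by (simp add: add_nonneg_pos)
  have \<rho>v: "2 * \<rho> * norm v < R/2"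
    unfolding \<rho>_def using R by (simp add: divide_simps add_nonneg_pos)
  have inR: "x + t *s v \<in> ball a R" if "x \<in> ball a (R/2)" "t \<in> cball 0 (2*\<rho>)" for x t
  proof -
    have "cmod t * norm v \<le> 2 * \<rho> * norm v" using that by (intro mult_right_mono) auto
    then have "norm (t *s v) < R/2" using \<rho>v by (simp add: norm_cvec_scale)
    then show ?thesis using that dist_triangle[of a "x + t *s v" x] by (simp add: dist_norm)
  qed
  have taylor: "cmod (f (x + t *s v) - f x - dird f x v * t) \<le> 2 * B / \<rho>^2 * (cmod t)^2"
    if x: "x \<in> ball a (R/2)" and t: "t \<in> ball 0 \<rho>" for x t
  proof -
    let ?F = "\<lambda>t. f (x + t *s v)"
    have hol: "?F holomorphic_on cball 0 (2*\<rho>)"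
    proof -
      have "cball 0 (2*\<rho>) \<subseteq> {t. x + t *s v \<in> U}" using inR[OF x] R by auto
      moreover have "?F holomorphic_on {t. x + t *s v \<in> U}"
        using holo_on_imp_line_holo[OF f] unfolding line_holo_def by blast
      ultimately show ?thesis by (rule holomorphic_on_subset[rotated])
    qed
    have hol': "?F holomorphic_on ball 0 (2*\<rho>)"
      using hol holomorphic_on_subset ball_subset_cball by blast
    have "cmod ((deriv ^^ 0) ?F t - (\<Sum>i\<le>1. (deriv ^^ i) ?F 0 * (t - 0)^i / fact i))
            \<le> (2 * B / \<rho>^2) * cmod (t - 0)^(Suc 1) / fact 1"
    proof (rule complex_Taylor[where S="ball 0 \<rho>"])
      fix i and s :: complex assume s: "s \<in> ball 0 \<rho>" and "i \<le> (1::nat)"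
      have "(deriv ^^ i) ?F holomorphic_on ball 0 (2*\<rho>)"
        by (intro holomorphic_higher_deriv hol') auto
      then show "((deriv ^^ i) ?F has_field_derivative (deriv ^^ Suc i) ?F s) (at s within ball 0 \<rho>)"
        using s \<rho> by (auto intro!: holomorphic_derivI[where S="ball 0 (2*\<rho>)"])
    next
      fix s :: complex assume s: "s \<in> ball 0 \<rho>"
      have sub: "cball s \<rho> \<subseteq> cball 0 (2*\<rho>)"
        using s by (intro cball_subset_cball_iff[THEN iffD2]) (auto simp: dist_commute)
      have "cmod ((deriv ^^ 2) ?F s) \<le> fact 2 * B / \<rho>^2"
      proof (rule Cauchy_inequality)
        show "?F holomorphic_on ball s \<rho>"
          using hol holomorphic_on_subset sub ball_subset_cball by blast
        show "continuous_on (cball s \<rho>) ?F"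
          using hol holomorphic_on_imp_continuous_on continuous_on_subset sub by blast
        fix y assume "cmod (s - y) = \<rho>"
        then have "y \<in> cball s \<rho>" by (simp add: dist_norm)
        then show "cmod (?F y) \<le> B" unfolding B_def using inR[OF x] sub R(3) by blast
      qed (use \<rho> in auto)
      then show "cmod ((deriv ^^ Suc 1) ?F s) \<le> 2 * B / \<rho>^2"
        by (simp add: numeral_2_eq_2)
    qed (use t \<rho> in auto)
    then show ?thesis by (simp add: dird_def power2_eq_square algebra_simps)
  qed
  \<comment> \<open>Shifting the index by \<open>N\<close> makes every step
    \<open>1 / (n + N)\<close> shorter than \<open>\<rho>\<close>, from \<open>n = 0\<close>
    on.\<close>
  obtain N where N: "1 / \<rho> < real N" using reals_Archimedean2 by blast
  let ?q = "\<lambda>n z. of_nat (n + N) * (f (z + (1 / of_nat (n + N)) *s v) - f z)"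
  have inv: "cmod (1 / of_nat (n + N)) < \<rho>" "n + N > 0" for n
  proof -
    have *: "1 / \<rho> < real (n + N)" using N by simp
    then show "n + N > 0" using \<rho> by (metis divide_pos_pos of_nat_0_less_iff order_less_trans zero_less_one)
    then show "cmod (1 / of_nat (n + N)) < \<rho>"
      using * \<rho> by (simp add: norm_divide divide_simps mult.commute del: of_nat_add)
  qed
  show "\<exists>L. ((\<lambda>z. dird f z v) has_derivative L) (at a) \<and> (\<forall>c v. L (c *s v) = c * L v)"
  proof (rule holo_uniform_limit_at)
    show "R/2 > 0" using R by simp
    fix n
    have in1: "z + (1 / of_nat (n + N)) *s v \<in> U" if "z \<in> ball a (R/2)" for z
      using inR[OF that, of "1 / of_nat (n + N)"] inv[of n] \<rho> R(2) by auto
    have in2: "ball a (R/2) \<subseteq> U" using R by auto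
    show "holo_on (ball a (R/2)) (?q n)"
      by (intro holo_on_cmult holo_on_diff holo_on_translate[OF f] holo_on_subset[OF f in2] in1)
  next
    show "uniform_limit (ball a (R/2)) ?q (\<lambda>z. dird f z v) sequentially"
    proof (rule uniform_limitI)
      fix e :: real assume "e > 0"
      have lim: "(\<lambda>n. 2 * B / \<rho>^2 * (1 / real (n + N))) \<longlonglongrightarrow> 2 * B / \<rho>^2 * 0"
        by (intro tendsto_mult tendsto_const LIMSEQ_ignore_initial_segment lim_1_over_n)
      have "\<forall>\<^sub>F n in sequentially. 2 * B / \<rho>^2 * (1 / real (n + N)) < e"
        using order_tendstoD(2)[OF lim, of e] \<open>e > 0\<close> by simp
      then show "\<forall>\<^sub>F n in sequentially. \<forall>x\<in>ball a (R/2). dist (?q n x) (dird f x v) < e"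
      proof eventually_elim
        case (elim n)
        show ?case
        proof
          fix x assume x: "x \<in> ball a (R/2)"
          let ?t = "1 / of_nat (n + N) :: complex"
          have ne: "of_nat (n + N) \<noteq> (0::complex)" using inv(2)[of n] of_nat_eq_0_iff by (metis less_irrefl)
          have "?q n x - dird f x v = of_nat (n + N) * (f (x + ?t *s v) - f x - dird f x v * ?t)"
            using ne by (simp add: algebra_simps del: of_nat_add)
          then have "cmod (?q n x - dird f x v) = real (n + N) * cmod (f (x + ?t *s v) - f x - dird f x v * ?t)"
            by (simp add: norm_mult del: of_nat_add)
          also have "\<dots> \<le> real (n + N) * (2 * B / \<rho>^2 * (cmod ?t)^2)"
            using taylor[OF x, of ?t] inv[of n] by (intro mult_left_mono) auto
          also have "\<dots> = 2 * B / \<rho>^2 * (1 / real (n + N))"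
            using inv(2)[of n] by (simp add: norm_divide power2_eq_square del: of_nat_add)
          finally show "dist (?q n x) (dird f x v) < e" using elim by (simp add: dist_norm)
        qed
      qed
    qed
  qed
qed

text \<open>Only the real part is maximal, so the maximum modulus principle is applied to the
  exponential of \<open>f\<close> on the complex line through \<open>a\<close> and \<open>b\<close>,
  where \<open>cmod (exp w) = exp (Re w)\<close>. Once the exponential is constant, values of
  \<open>f\<close> on the slice differ by multiples of \<open>2 * pi * \<i>\<close>, and continuity
  on a connected slice leaves a single value.\<close>

lemma holo_max_principle:
  assumes f: "holo_on (ball a r) f" and max: "\<And>z. z \<in> ball a r \<Longrightarrow> Re (f z) \<le> Re (f a)" and b: "b \<in> ball a r"
  shows "f b = f a"
proof -
  let ?S = "{t. a + t *s (b - a) \<in> ball a r}" and ?F = "\<lambda>t. f (a + t *s (b - a))"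
  have hol: "?F holomorphic_on ?S"
    using holo_on_imp_line_holo[OF f] unfolding line_holo_def by blast
  have S: "open ?S" "connected ?S" "0 \<in> ?S" "1 \<in> ?S"
    using open_cvec_line[of "ball a r" a "b - a"] convex_connected[OF convex_cvec_line[of "ball a r" a "b - a"]]
      b le_less_trans[OF zero_le_dist, of a b r] by auto
  have "(\<lambda>t. exp (?F t)) constant_on ?S"
    using S max by (intro maximum_modulus_principle[where \<xi>=0 and U="?S"] holomorphic_intros hol) auto
  then have const: "exp (?F t) = exp (?F 0)" if "t \<in> ?S" for t
    using that S(3) unfolding constant_on_def by metis
  have "?F constant_on ?S"
  proof (rule continuous_discrete_range_constant[OF S(2) holomorphic_on_imp_continuous_on[OF hol]])
    fix x assume x: "x \<in> ?S"
    show "\<exists>e>0. \<forall>y. y \<in> ?S \<and> ?F y \<noteq> ?F x \<longrightarrow> e \<le> norm (?F y - ?F x)"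
    proof (intro exI[of _ "2*pi"] conjI allI impI)
      fix y assume y: "y \<in> ?S \<and> ?F y \<noteq> ?F x"
      then have "exp (?F y) = exp (?F x)" using const x by metis
      then obtain k :: int where k: "?F y = ?F x + of_int (2 * k) * pi * \<i>"
        unfolding exp_eq by (auto simp: algebra_simps)
      with y have "k \<noteq> 0" by auto
      then have "1 * (2 * pi) \<le> \<bar>real_of_int k\<bar> * (2 * pi)" by (intro mult_right_mono) (linarith, simp)
      moreover have "?F y - ?F x = of_int (2 * k) * pi * \<i>" using k by simp
      ultimately show "2 * pi \<le> norm (?F y - ?F x)" by (simp only:) (simp add: norm_mult)
    qed simp
  qed
  then have "?F 1 = ?F 0" using S unfolding constant_on_def by metis
  then show ?thesis by (simp add: vec_eq_iff)
qed

section \<open>The complex Jacobian: local injectivity and degenerate images\<close>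

definition jac :: "(('n::finite) cvec \<Rightarrow> 'n cvec) \<Rightarrow> 'n cvec \<Rightarrow> complex^'n^'n" where
  "jac \<Phi> z = (\<chi> i j. dird (\<lambda>w. \<Phi> w $ i) z (axis j 1))"

text \<open>Complex linearity makes the derivatives along \<open>axis j 1\<close> determine the
  whole real derivative, including the directions \<open>axis j \<i>\<close>.\<close>

lemma jac_has_derivative:
  assumes "holo_map_on U \<Phi>" "z \<in> U"
  shows "(\<Phi> has_derivative (\<lambda>v. jac \<Phi> z *v v)) (at z)"
proof -
  have hol: "holo_on U (\<lambda>w. \<Phi> w $ i)" for i using assms(1) by (simp add: holo_map_on_def)
  have eq: "(jac \<Phi> z *v v) $ i = dird (\<lambda>w. \<Phi> w $ i) z v" for v i
  proof -
    let ?L = "dird (\<lambda>w. \<Phi> w $ i) z"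
    have L: "linear ?L"
      using holo_on_has_derivative(1)[OF hol assms(2)] by (rule has_derivative_linear)
    have "?L v = ?L (\<Sum>j\<in>UNIV. (v $ j) *s axis j 1)" by (simp only: basis_expansion)
    also have "\<dots> = (\<Sum>j\<in>UNIV. ?L ((v $ j) *s axis j 1))" by (rule linear_sum[OF L])
    also have "\<dots> = (\<Sum>j\<in>UNIV. v $ j * ?L (axis j 1))"
      using holo_on_has_derivative(2)[OF hol assms(2)] by simp
    finally show ?thesis by (simp add: jac_def matrix_vector_mult_def mult.commute)
  qed
  have "((\<lambda>w. \<Phi> w \<bullet> b) has_derivative (\<lambda>v. (jac \<Phi> z *v v) \<bullet> b)) (at z)" if "b \<in> Basis" for b
  proof -
    from that obtain i u where b: "b = axis i u" unfolding Basis_vec_def by blast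
    have "((\<lambda>w. \<Phi> w $ i) has_derivative (\<lambda>v. (jac \<Phi> z *v v) $ i)) (at z)"
      using holo_on_has_derivative(1)[OF hol assms(2)] by (simp add: eq)
    then show ?thesis unfolding b inner_axis by (rule has_derivative_inner_left)
  qed
  then show ?thesis using has_derivative_componentwise_within[of \<Phi> _ z UNIV] by blast
qed

lemma holo_on_sum: "(\<And>i. i \<in> I \<Longrightarrow> holo_on U (f i)) \<Longrightarrow> holo_on U (\<lambda>z. \<Sum>i\<in>I. f i z)"
  by (induction I rule: infinite_finite_induct) (auto intro: holo_on_add)

lemma holo_on_prod: "(\<And>i. i \<in> I \<Longrightarrow> holo_on U (f i)) \<Longrightarrow> holo_on U (\<lambda>z. \<Prod>i\<in>I. f i z)"
  by (induction I rule: infinite_finite_induct) (auto intro: holo_on_mult)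

lemma holo_on_jac:
  assumes "holo_map_on U \<Phi>" "open U"
  shows "holo_on U (\<lambda>z. jac \<Phi> z $ i $ j)"
  using assms by (simp add: jac_def holo_on_dird holo_map_on_def)

lemma holo_on_det_jac:
  assumes "holo_map_on U \<Phi>" "open U"
  shows "holo_on U (\<lambda>z. det (jac \<Phi> z))"
  unfolding det_def by (intro holo_on_sum holo_on_cmult holo_on_prod holo_on_jac assms)

lemma holo_map_continuous_on:
  fixes \<Phi> :: "'n::finite cvec \<Rightarrow> 'n cvec"
  assumes "holo_map_on U \<Phi>" shows "continuous_on U \<Phi>"
  using assms jac_has_derivative has_derivative_continuous continuous_at_imp_continuous_on by metis

text \<open>Reduces closeness of Jacobians in operator norm to closeness of their entries, which are
  continuous because they are holomorphic.\<close>

lemma onorm_cmatrix_le: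
  "onorm (\<lambda>v. (A :: complex^'n::finite^'m::finite) *v v) \<le> (\<Sum>i\<in>UNIV. \<Sum>j\<in>UNIV. cmod (A $ i $ j))"
proof (rule onorm_bound)
  fix v :: "complex^'n"
  have "norm (A *v v) \<le> (\<Sum>i\<in>UNIV. cmod ((A *v v) $ i))"
    unfolding norm_vec_def by (rule L2_set_le_sum) simp
  also have "\<dots> \<le> (\<Sum>i\<in>UNIV. \<Sum>j\<in>UNIV. cmod (A $ i $ j) * norm v)"
  proof (rule sum_mono)
    fix i
    have "cmod ((A *v v) $ i) \<le> (\<Sum>j\<in>UNIV. cmod (A $ i $ j * v $ j))"
      unfolding matrix_vector_mult_def by (simp add: norm_sum)
    also have "\<dots> \<le> (\<Sum>j\<in>UNIV. cmod (A $ i $ j) * norm v)"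
      by (intro sum_mono) (auto simp: norm_mult intro!: mult_left_mono Finite_Cartesian_Product.norm_nth_le)
    finally show "cmod ((A *v v) $ i) \<le> (\<Sum>j\<in>UNIV. cmod (A $ i $ j) * norm v)" .
  qed
  finally show "norm (A *v v) \<le> (\<Sum>i\<in>UNIV. \<Sum>j\<in>UNIV. cmod (A $ i $ j)) * norm v"
    by (simp add: sum_distrib_right)
qed (simp add: sum_nonneg)

text \<open>The Jacobian is invertible at \<open>q\<close> and varies continuously in operator norm,
  its entries being holomorphic by \<open>holo_on_dird\<close>; this is the input of
  \<open>has_derivative_locally_injective\<close>.\<close>

lemma holo_map_locally_injective:
  assumes \<Phi>: "holo_map_on U \<Phi>" "open U" and q: "q \<in> U" "det (jac \<Phi> q) \<noteq> 0"
  obtains r where "r > 0" "ball q r \<subseteq> U" "inj_on \<Phi> (ball q r)"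
proof -
  let ?A = "jac \<Phi> q"
  obtain B where B: "B ** ?A = mat 1" using q invertible_det_nz unfolding invertible_def by blast
  show ?thesis
  proof (rule has_derivative_locally_injective[where f' = "\<lambda>z v. jac \<Phi> z *v v" and S = U and a = q and f = \<Phi>])
    show "bounded_linear (\<lambda>v. B *v v)" by simp
    show "(\<lambda>v. B *v v) \<circ> (\<lambda>v. ?A *v v) = id"
      using B by (auto simp: matrix_vector_mul_assoc)
    fix e :: real assume e: "e > 0"
    define F where "F z = (\<Sum>i\<in>UNIV. \<Sum>j\<in>UNIV. cmod (jac \<Phi> z $ i $ j - ?A $ i $ j))" for z
    have "continuous_on U F"
      unfolding F_def by (intro continuous_intros holo_on_continuous_on[OF holo_on_jac[OF \<Phi>]])
    then have "isCont F q" using \<Phi> q by (simp add: continuous_on_eq_continuous_at)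
    moreover have "F q = 0" by (simp add: F_def)
    ultimately obtain d where d: "d > 0" "\<And>x. dist x q < d \<Longrightarrow> \<bar>F x\<bar> < e"
      using e unfolding continuous_at_eps_delta by (auto simp: dist_real_def)
    have "onorm (\<lambda>v. jac \<Phi> x *v v - ?A *v v) < e" if "dist q x < d" for x
    proof -
      have "(\<lambda>v. jac \<Phi> x *v v - ?A *v v) = (\<lambda>v. (jac \<Phi> x - ?A) *v v)"
        by (simp add: matrix_vector_mult_diff_rdistrib)
      then have "onorm (\<lambda>v. jac \<Phi> x *v v - ?A *v v) \<le> F x"
        using onorm_cmatrix_le[of "jac \<Phi> x - ?A"] by (simp add: F_def)
      then show ?thesis using d(2)[of x] that by (simp add: dist_commute)
    qed
    then show "\<exists>d>0. \<forall>x. dist q x < d \<longrightarrow> onorm (\<lambda>v. jac \<Phi> x *v v - ?A *v v) < e"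
      using d(1) by blast
  qed (use \<Phi> q jac_has_derivative that in auto)
qed

text \<open>\<open>baby_Sard\<close> is stated for \<open>real^'m\<close> with a well-ordered index type of cardinality \<open>2n\<close>;
  \<open>'n bit0\<close> is such a type.\<close>

lemma holo_map_degenerate_image:
  fixes \<Phi> :: "'n::finite cvec \<Rightarrow> 'n cvec"
  assumes \<Phi>: "holo_map_on U \<Phi>" and S: "S \<subseteq> U" and det: "\<And>z. z \<in> S \<Longrightarrow> det (jac \<Phi> z) = 0"
  shows "interior (\<Phi> ` S) = {}"
proof -
  have dim: "DIM('n cvec) = DIM(real^'n bit0)" by simp
  obtain e :: "'n cvec \<Rightarrow> real^'n bit0" and e' where
    lin: "linear e" "linear e'" and e'e: "\<And>x. e' (e x) = x" and ee': "\<And>y. e (e' y) = y"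
    by (rule isomorphisms_UNIV_UNIV[OF dim]) blast
  let ?f = "\<lambda>x. e (\<Phi> (e' x))" and ?f' = "\<lambda>x v. e (jac \<Phi> (e' x) *v e' v)"
  have "negligible (?f ` (e ` S))"
  proof (rule baby_Sard)
    fix x assume "x \<in> e ` S"
    then have x: "e' x \<in> S" using e'e by auto
    have "(e' has_derivative e') (at x)" "(e has_derivative e) (at (\<Phi> (e' x)))"
      using lin by (simp_all add: linear_imp_has_derivative)
    then have "(?f has_derivative ?f' x) (at x)"
      using has_derivative_compose[OF has_derivative_compose[OF _ jac_has_derivative[OF \<Phi>]], of e' e' x UNIV e e] x S
      by auto
    then show "(?f has_derivative ?f' x) (at x within e ` S)" by (rule has_derivative_at_withinI)
    have "\<not> surj (\<lambda>v. jac \<Phi> (e' x) *v v)"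
    proof
      assume "surj (\<lambda>v. jac \<Phi> (e' x) *v v)"
      then have "invertible (jac \<Phi> (e' x))"
        using matrix_right_invertible_surjective[of "jac \<Phi> (e' x)"] invertible_right_inverse[of "jac \<Phi> (e' x)"]
        by blast
      then show False using det[OF x] invertible_det_nz by blast
    qed
    have "\<not> surj (?f' x)"
    proof
      assume surj: "surj (?f' x)"
      have "\<exists>v. y = jac \<Phi> (e' x) *v v" for y
      proof -
        obtain u where "e y = ?f' x u" using surj unfolding surj_def by blast
        then have "e' (e y) = e' (?f' x u)" by simp
        then show ?thesis by (auto simp: e'e)
      qed
      then show False using \<open>\<not> surj (\<lambda>v. jac \<Phi> (e' x) *v v)\<close> by (simp add: surj_def)
    qed
    moreover have "linear (?f' x)"
      using linear_compose[OF linear_compose[OF lin(2) matrix_vector_mul_bounded_linear[THEN bounded_linear.linear]] lin(1)]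
      by (simp add: o_def)
    then have "(\<lambda>v. matrix (?f' x) *v v) = ?f' x" by simp
    ultimately have "rank (matrix (?f' x)) \<noteq> CARD('n bit0)"
      using full_rank_surjective[of "matrix (?f' x)"] by simp
    then show "rank (matrix (?f' x)) < CARD('n bit0)"
      using rank_bound[of "matrix (?f' x)"] by simp
  qed simp
  then have neg: "negligible (e ` \<Phi> ` S)" by (simp add: image_image e'e)
  have "surj e" using ee' by (metis surjI)
  then have "open (e ` interior (\<Phi> ` S))" using lin by (intro open_surjective_linear_image) auto
  moreover have "negligible (e ` interior (\<Phi> ` S))"
    using neg by (rule negligible_subset) (use interior_subset in blast)
  ultimately show ?thesis using open_not_negligible by blast
qed

section \<open>Geometric preparations for the enlargement\<close>

text \<open>A neighbourhood \<open>N\<close> of a boundary point that lay in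
  \<open>closure A\<close> would lie in the interior of that closure, and the point would not be on
  the frontier. So \<open>N\<close> has a point off \<open>closure A\<close>, hence a ball off
  it.\<close>

lemma prop2_interior_closure: "prop2 (interior (closure A))"
  unfolding prop2_def
proof (intro ballI allI impI)
  fix \<zeta> N assume \<zeta>: "\<zeta> \<in> frontier (interior (closure A))" and N: "open N \<and> \<zeta> \<in> N"
  have "\<not> N \<subseteq> closure A"
  proof
    assume "N \<subseteq> closure A"
    then have "N \<subseteq> interior (closure A)" using N interior_maximal by blast
    then show False using \<zeta> N by (auto simp: frontier_def)
  qed
  then obtain c where "c \<in> N - closure A" by blast
  then obtain r where "r > 0" "ball c r \<subseteq> N - closure A"
    using N open_contains_ball[of "N - closure A"] by (auto simp: open_Diff)
  then show "\<exists>c r. 0 < r \<and> ball c r \<subseteq> N - interior (closure A)"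
    using interior_subset by blast
qed

text \<open>Passing to the interior of the closure creates no new boundary points, so null frontiers
  stay null.\<close>

lemma frontier_interior_closure_subset:
  assumes "open A" shows "frontier (interior (closure A)) \<subseteq> frontier A"
proof -
  have "closure (interior (closure A)) \<subseteq> closure A"
    by (intro closure_minimal interior_subset) simp
  moreover have "A \<subseteq> interior (closure A)" using assms by (intro interior_maximal closure_subset)
  ultimately show ?thesis using assms by (auto simp: frontier_def interior_open)
qed

text \<open>A local maximum of the real part makes the coordinate constant near
  \<open>\<zeta>\<close>, hence on \<open>\<Omega>\<close>; then the image of
  \<open>\<Omega>\<close> lies in a hyperplane and has no interior. \<open>U\<close> may be
  disconnected, so the identity theorem is run on \<open>\<Omega>\<close>, which meets the ball
  because \<open>\<zeta>\<close> lies in its closure.\<close>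

lemma holo_coordinate_not_locally_maximal:
  fixes \<Phi> :: "'n::finite cvec \<Rightarrow> 'n cvec"
  assumes \<Omega>: "open \<Omega>" "connected \<Omega>" and \<zeta>: "\<zeta> \<in> closure \<Omega>" and U: "\<Omega> \<subseteq> U" "holo_map_on U \<Phi>"
    and int: "interior (\<Phi> ` \<Omega>) \<noteq> {}" and \<delta>: "\<delta> > 0" "ball \<zeta> \<delta> \<subseteq> U"
  shows "\<exists>z\<in>ball \<zeta> \<delta>. Re (\<Phi> \<zeta> $ j) < Re (\<Phi> z $ j)"
proof (rule ccontr)
  assume "\<not> ?thesis"
  then have max: "Re (\<Phi> z $ j) \<le> Re (\<Phi> \<zeta> $ j)" if "z \<in> ball \<zeta> \<delta>" for z using that by force
  have hol: "holo_on U (\<lambda>z. \<Phi> z $ j)" using U by (simp add: holo_map_on_def)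
  have const: "\<Phi> z $ j = \<Phi> \<zeta> $ j" if "z \<in> ball \<zeta> \<delta>" for z
    using holo_max_principle[OF holo_on_subset[OF hol \<delta>(2)] max that] .
  have const: "\<Phi> z $ j = \<Phi> \<zeta> $ j" if z: "z \<in> \<Omega>" for z
  proof -
    have "\<Phi> z $ j - \<Phi> \<zeta> $ j = 0"
    proof (rule line_holo_identity[of \<Omega> "\<lambda>z. \<Phi> z $ j - \<Phi> \<zeta> $ j" "\<Omega> \<inter> ball \<zeta> \<delta>"])
      show "line_holo \<Omega> (\<lambda>z. \<Phi> z $ j - \<Phi> \<zeta> $ j)"
        by (intro holo_on_imp_line_holo holo_on_diff holo_on_subset[OF hol U(1)] holo_on_const)
      have "\<zeta> \<in> ball \<zeta> \<delta> \<inter> closure \<Omega>" using \<zeta> \<delta>(1) by simp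
      then show "\<Omega> \<inter> ball \<zeta> \<delta> \<noteq> {}"
        using open_Int_closure_eq_empty[of "ball \<zeta> \<delta>" \<Omega>] by blast
    qed (use \<Omega> z const in auto)
    then show ?thesis by simp
  qed
  obtain y where "y \<in> interior (\<Phi> ` \<Omega>)" using int by blast
  then obtain e where e: "e > 0" "cball y e \<subseteq> \<Phi> ` \<Omega>"
    by (meson mem_interior_cball)
  \<comment> \<open>A second point of the ball in the image, differing from \<open>y\<close> in the
    \<open>j\<close>-th coordinate.\<close>
  let ?y = "y + of_real e *s axis j 1"
  have coord: "w $ j = \<Phi> \<zeta> $ j" if w: "w \<in> cball y e" for w
  proof -
    obtain z where "z \<in> \<Omega>" "w = \<Phi> z" using w e(2) by blast
    then show ?thesis using const by simp
  qed
  have "y \<in> cball y e" "?y \<in> cball y e" using e by (auto simp: dist_norm norm_cvec_scale)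
  from this[THEN coord] show False using e by (simp add: axis_def)
qed

text \<open>The least element of the compact set where \<open>s \<le> p\<close>; by the intermediate
  value theorem the value \<open>s\<close> is taken no later, and no earlier by minimality.\<close>

lemma first_hit:
  fixes p :: "real \<Rightarrow> real"
  assumes p: "continuous_on {0..1} p" and s: "p 0 < s" "s < p 1"
  obtains t where "0 < t" "t \<le> 1" "p t = s" "\<And>u. 0 \<le> u \<Longrightarrow> u < t \<Longrightarrow> p u < s"
proof -
  let ?H = "{t \<in> {0..1}. s \<le> p t}"
  have "closed ?H"
    using continuous_closed_preimage[OF p, of "{s..}"] by (simp add: vimage_def Int_def)
  then have "compact ({0..1} \<inter> ?H)" by (intro compact_Int_closed) auto
  moreover have "{0..1} \<inter> ?H = ?H" by auto
  ultimately have "compact ?H" by simp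
  moreover have "1 \<in> ?H" using s by simp
  ultimately obtain t where t: "t \<in> ?H" "\<And>u. u \<in> ?H \<Longrightarrow> t \<le> u"
    using compact_attains_inf[of ?H] by blast
  have less: "p u < s" if "0 \<le> u" "u < t" for u using t(2)[of u] t(1) that by force
  have "\<exists>u\<ge>0. u \<le> t \<and> p u = s"
    using s t(1) by (intro IVT') (auto intro: continuous_on_subset[OF p])
  then obtain u where "0 \<le> u" "u \<le> t" "p u = s" by blast
  then have "p t = s" using less[of u] by (cases "u = t") auto
  moreover have "t \<noteq> 0" using s \<open>p t = s\<close> by auto
  ultimately show ?thesis using t(1) less by (intro that[of t]) auto
qed

section \<open>The Bergman space\<close>

lemma nn_integral_lborel_shift:
  fixes g :: "'a::euclidean_space \<Rightarrow> ennreal"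
  assumes [measurable]: "g \<in> borel_measurable borel"
  shows "(\<integral>\<^sup>+x. g (x + c) \<partial>lborel) = (\<integral>\<^sup>+x. g x \<partial>lborel)"
proof -
  have "(\<integral>\<^sup>+x. g x \<partial>lborel) = (\<integral>\<^sup>+x. g x \<partial>distr lborel borel ((+) c))"
    by (simp add: lborel_distr_plus)
  also have "\<dots> = (\<integral>\<^sup>+x. g (c + x) \<partial>lborel)" by (rule nn_integral_distr) auto
  finally show ?thesis by (simp add: add.commute)
qed

text \<open>Uniqueness of Haar measure, in the case needed here: evaluate the double integral of
  \<open>indicator A (f x + y) * indicator (ball 0 1) y\<close> in both orders.\<close>

lemma lborel_distr_isometry:
  fixes f :: "'a::euclidean_space \<Rightarrow> 'a"
  assumes lin: "linear f" and norm: "\<And>x. norm (f x) = norm x"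
  shows "distr lborel borel f = lborel"
proof (rule measure_eqI)
  fix A assume "A \<in> sets (distr lborel borel f)"
  then have A [measurable]: "A \<in> sets borel" by simp
  let ?B = "ball 0 1 :: 'a set"
  have [measurable]: "?B \<in> sets borel" by simp
  have cont: "continuous_on UNIV f" using lin by (simp add: linear_continuous_on linear_conv_bounded_linear)
  have [measurable]: "f \<in> borel_measurable borel" by (rule borel_measurable_continuous_onI[OF cont])
  have "inj f" using lin norm by (metis linear_injective_0 norm_eq_zero)
  then have "surj f" using lin linear_injective_imp_surjective by blast
  then have inv: "\<exists>y'. y = f y'" for y by (metis surjD)
  have "(\<integral>\<^sup>+x. (\<integral>\<^sup>+y. indicator A (f x + y) * indicator ?B y \<partial>lborel) \<partial>lborel)
      = (\<integral>\<^sup>+y. (\<integral>\<^sup>+x. indicator A (f x + y) * indicator ?B y \<partial>lborel) \<partial>lborel)"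
    by (rule lborel_pair.Fubini'[symmetric]) measurable
  also have "\<dots> = (\<integral>\<^sup>+y. emeasure (distr lborel borel f) A * indicator ?B y \<partial>lborel)"
  proof (rule nn_integral_cong)
    fix y
    obtain y' where y': "y = f y'" using inv by blast
    have "(\<integral>\<^sup>+x. indicator A (f x + y) * indicator ?B y \<partial>lborel)
        = (\<integral>\<^sup>+x. indicator A (f x + y) \<partial>lborel) * indicator ?B y"
      by (rule nn_integral_multc) measurable
    also have "(\<integral>\<^sup>+x. indicator A (f x + y) \<partial>lborel) = (\<integral>\<^sup>+x. indicator A (f (x + y')) \<partial>lborel)"
      using lin by (simp add: y' linear_add)
    also have "\<dots> = (\<integral>\<^sup>+x. indicator A (f x) \<partial>lborel)"
      by (rule nn_integral_lborel_shift[of "\<lambda>x. indicator A (f x)"]) measurable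
    also have "\<dots> = (\<integral>\<^sup>+x. indicator A x \<partial>distr lborel borel f)"
      by (rule nn_integral_distr[symmetric]) auto
    also have "\<dots> = emeasure (distr lborel borel f) A" by simp
    finally show "(\<integral>\<^sup>+x. indicator A (f x + y) * indicator ?B y \<partial>lborel) =
      emeasure (distr lborel borel f) A * indicator ?B y" .
  qed
  also have "\<dots> = emeasure (distr lborel borel f) A * emeasure lborel ?B"
    by (subst nn_integral_cmult) auto
  finally have 1: "(\<integral>\<^sup>+x. (\<integral>\<^sup>+y. indicator A (f x + y) * indicator ?B y \<partial>lborel) \<partial>lborel)
    = emeasure (distr lborel borel f) A * emeasure lborel ?B" .
  have "(\<integral>\<^sup>+x. (\<integral>\<^sup>+y. indicator A (f x + y) * indicator ?B y \<partial>lborel) \<partial>lborel)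
      = (\<integral>\<^sup>+x. (\<integral>\<^sup>+y. indicator A y * indicator ?B (y - f x) \<partial>lborel) \<partial>lborel)"
  proof (rule nn_integral_cong)
    fix x
    have "(\<integral>\<^sup>+y. indicator A (f x + y) * indicator ?B y \<partial>lborel)
        = (\<integral>\<^sup>+y. indicator A (f x + (y + - f x)) * indicator ?B (y + - f x) \<partial>lborel)"
      by (rule nn_integral_lborel_shift[symmetric]) measurable
    then show "(\<integral>\<^sup>+y. indicator A (f x + y) * indicator ?B y \<partial>lborel)
        = (\<integral>\<^sup>+y. indicator A y * indicator ?B (y - f x) \<partial>lborel)" by simp
  qed
  also have "\<dots> = (\<integral>\<^sup>+y. (\<integral>\<^sup>+x. indicator A y * indicator ?B (y - f x) \<partial>lborel) \<partial>lborel)"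
    by (rule lborel_pair.Fubini'[symmetric]) measurable
  also have "\<dots> = (\<integral>\<^sup>+y. indicator A y * emeasure lborel ?B \<partial>lborel)"
  proof (rule nn_integral_cong)
    fix y
    obtain y' where y': "y = f y'" using inv by blast
    have "indicator ?B (y - f x) = (indicator ?B (x + - y') :: ennreal)" for x
    proof -
      have "norm (y - f x) = norm (f (y' - x))" using lin by (simp add: y' linear_diff)
      then show ?thesis by (simp add: norm indicator_def norm_minus_commute)
    qed
    then have "(\<integral>\<^sup>+x. indicator A y * indicator ?B (y - f x) \<partial>lborel)
       = (\<integral>\<^sup>+x. indicator A y * indicator ?B (x + - y') \<partial>lborel)" by simp
    also have "\<dots> = indicator A y * (\<integral>\<^sup>+x. indicator ?B (x + - y') \<partial>lborel)"
      by (rule nn_integral_cmult) measurable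
    also have "(\<integral>\<^sup>+x. indicator ?B (x + - y') \<partial>lborel) = (\<integral>\<^sup>+x. indicator ?B x \<partial>lborel)"
      by (rule nn_integral_lborel_shift) measurable
    finally show "(\<integral>\<^sup>+x. indicator A y * indicator ?B (y - f x) \<partial>lborel) = indicator A y * emeasure lborel ?B"
      by simp
  qed
  also have "\<dots> = emeasure lborel A * emeasure lborel ?B"
    by (subst nn_integral_multc) auto
  finally have "emeasure (distr lborel borel f) A * emeasure lborel ?B = emeasure lborel A * emeasure lborel ?B"
    using 1 by simp
  moreover have "unit_ball_vol (real DIM('a)) \<noteq> 0"
    using unit_ball_vol_pos[of "real DIM('a)"] by (metis less_irrefl of_nat_0_le_iff)
  then have "emeasure lborel ?B \<noteq> 0" "emeasure lborel ?B \<noteq> top"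
    using emeasure_bounded_finite[of ?B] by (auto simp: emeasure_ball)
  ultimately show "emeasure (distr lborel borel f) A = emeasure lborel A"
    by (simp add: mult.commute[of _ "emeasure lborel ?B"] ennreal_mult_cancel_left)
qed simp

lemma holomorphic_circle_mean:
  assumes "F holomorphic_on cball 0 1"
  shows "((\<lambda>t. F (exp (2 * of_real pi * \<i> * of_real t))) has_integral F 0) {0..1}"
proof -
  have "((\<lambda>u. F u / (u - 0)) has_contour_integral (2 * of_real pi * \<i> * F 0)) (circlepath 0 1)"
    by (rule Cauchy_integral_circlepath_simple) (use assms in auto)
  then have "((\<lambda>t. (2 * of_real pi * \<i>) * F (exp (2 * of_real pi * \<i> * of_real t))) has_integral (2 * of_real pi * \<i>) * F 0) {0..1}"
    unfolding has_contour_integral vector_derivative_circlepath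
    by (simp add: circlepath mult.assoc mult.commute mult.left_commute)
  from has_integral_mult_right[OF this, of "1 / (2 * of_real pi * \<i>)"] show ?thesis by simp
qed

text \<open>On each disc \<open>s \<mapsto> z + s *s w\<close> the one-variable mean value property
  bounds \<open>(cmod (f z))\<^sup>2\<close> by a mean over \<open>cmod s = 1\<close>. Integrating
  over \<open>w\<close> in the ball and exchanging integrals leaves rotated copies of one integral,
  all equal because multiplication by a unimodular scalar preserves Lebesgue measure.\<close>

lemma holo_sub_mean_value:
  fixes z :: "'n::finite cvec"
  assumes f: "holo_on (ball z r) f" and "r > 0"
  shows "ennreal ((cmod (f z))\<^sup>2) * emeasure lborel (ball (0::'n cvec) r)
    \<le> (\<integral>\<^sup>+w. ennreal (indicator (ball z r) w *\<^sub>R (cmod (f w))\<^sup>2) \<partial>lborel)"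
proof -
  let ?e = "\<lambda>t::real. exp (2 * of_real pi * \<i> * of_real t)"
  \<comment> \<open>Recentred at 0, where the rotations are linear isometries, and extended by
    zero.\<close>
  define g where "g w = ennreal (indicator (ball 0 r) w *\<^sub>R (cmod (f (w + z)))\<^sup>2)" for w
  have g [measurable]: "g \<in> borel_measurable borel"
    unfolding g_def
    by (intro measurable_compose[OF _ measurable_ennreal] borel_measurable_continuous_on_indicator
        continuous_intros continuous_on_compose2[OF holo_on_continuous_on[OF f]])
      (auto simp: dist_norm)
  have joint: "(\<lambda>(t, w). g (?e t *s w)) \<in> borel_measurable (lborel \<Otimes>\<^sub>M lborel)"
  proof -
    have "continuous_on UNIV (\<lambda>p. ?e (fst p) *s (snd p :: 'n cvec))"
      unfolding vector_scalar_mult_def by (intro continuous_intros)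
    then have "(\<lambda>p. g (?e (fst p) *s snd p)) \<in> borel_measurable borel"
      by (intro measurable_compose[OF borel_measurable_continuous_onI g])
    then show ?thesis
      by (simp add: case_prod_beta' measurable_cong_sets[OF sets_pair_measure_cong[OF sets_lborel sets_lborel] refl] borel_prod)
  qed
  have point: "ennreal ((cmod (f z))\<^sup>2) * indicator (ball 0 r) w
      \<le> (\<integral>\<^sup>+t. g (?e t *s w) * indicator {0..1} t \<partial>lborel)" for w
  proof (cases "w \<in> ball 0 r")
    case True
    \<comment> \<open>The square is holomorphic and its modulus is the squared modulus of
      \<open>f\<close>, so the mean value property of \<open>?F\<close> yields the quadratic bound
      directly.\<close>
    let ?F = "\<lambda>s. (f (z + s *s w))\<^sup>2"
    have sub: "cball 0 1 \<subseteq> {s. z + s *s w \<in> ball z r}"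
    proof
      fix s :: complex assume "s \<in> cball 0 1"
      then have "cmod s * norm w \<le> 1 * norm w" by (intro mult_right_mono) auto
      then show "s \<in> {s. z + s *s w \<in> ball z r}" using True by (simp add: dist_norm norm_cvec_scale)
    qed
    have "(\<lambda>s. f (z + s *s w)) holomorphic_on {s. z + s *s w \<in> ball z r}"
      using holo_on_imp_line_holo[OF f] unfolding line_holo_def by blast
    then have hol: "?F holomorphic_on cball 0 1"
      by (intro holomorphic_intros) (rule holomorphic_on_subset[OF _ sub])
    have mean: "((\<lambda>t. ?F (?e t)) has_integral ?F 0) {0..1}" by (rule holomorphic_circle_mean[OF hol])
    have cont: "continuous_on {0..1} (\<lambda>t. cmod (?F (?e t)))"
      by (intro continuous_intros continuous_on_compose2[OF holomorphic_on_imp_continuous_on[OF hol]]) auto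
    then have int: "(\<lambda>t. cmod (?F (?e t))) integrable_on {0..1}" by (rule integrable_continuous_interval)
    have "(cmod (f z))\<^sup>2 \<le> integral {0..1} (\<lambda>t. cmod (?F (?e t)))"
      using integral_norm_bound_integral[OF has_integral_integrable[OF mean] int] integral_unique[OF mean]
      by (simp add: norm_power)
    then have "ennreal ((cmod (f z))\<^sup>2) \<le> ennreal (integral {0..1} (\<lambda>t. cmod (?F (?e t))))"
      by (rule ennreal_leI)
    also have "\<dots> = (\<integral>\<^sup>+t. ennreal (cmod (?F (?e t))) * indicator {0..1} t \<partial>lborel)"
      by (rule nn_integral_has_integral_lebesgue'[symmetric]) (use int in auto)
    also have "\<dots> = (\<integral>\<^sup>+t. g (?e t *s w) * indicator {0..1} t \<partial>lborel)"
    proof (rule nn_integral_cong)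
      fix t :: real
      show "ennreal (cmod (?F (?e t))) * indicator {0..1} t = g (?e t *s w) * indicator {0..1} t"
        using True by (auto simp: g_def indicator_def norm_cvec_scale norm_power add.commute)
    qed
    finally show ?thesis using True by simp
  qed simp
  have "ennreal ((cmod (f z))\<^sup>2) * emeasure lborel (ball (0::'n cvec) r)
      = (\<integral>\<^sup>+w. ennreal ((cmod (f z))\<^sup>2) * indicator (ball (0::'n cvec) r) w \<partial>lborel)"
    by (simp add: nn_integral_cmult_indicator)
  also have "\<dots> \<le> (\<integral>\<^sup>+w. (\<integral>\<^sup>+t. g (?e t *s w) * indicator {0..1} t \<partial>lborel) \<partial>lborel)"
    by (intro nn_integral_mono point)
  also have "\<dots> = (\<integral>\<^sup>+t. (\<integral>\<^sup>+w. g (?e t *s w) * indicator {0..1} t \<partial>lborel) \<partial>lborel)"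
    by (rule lborel_pair.Fubini') (use joint in measurable)
  also have "\<dots> = (\<integral>\<^sup>+t. (\<integral>\<^sup>+w. g w \<partial>lborel) * indicator {0..1::real} t \<partial>lborel)"
  proof (rule nn_integral_cong)
    fix t :: real
    let ?R = "\<lambda>w::'n cvec. ?e t *s w"
    have "linear ?R" by (auto intro!: linearI simp: vec_eq_iff algebra_simps)
    moreover have "norm (?R w) = norm w" for w by (simp add: norm_cvec_scale)
    ultimately have R: "distr lborel borel ?R = lborel" by (rule lborel_distr_isometry)
    have Rm: "?R \<in> borel_measurable borel"
      unfolding vector_scalar_mult_def by (intro borel_measurable_continuous_onI continuous_intros)
    have "(\<integral>\<^sup>+w. g (?R w) * indicator {0..1} t \<partial>lborel) = (\<integral>\<^sup>+w. g (?R w) \<partial>lborel) * indicator {0..1} t"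
      by (rule nn_integral_multc) (use Rm in measurable)
    also have "(\<integral>\<^sup>+w. g (?R w) \<partial>lborel) = (\<integral>\<^sup>+w. g w \<partial>distr lborel borel ?R)"
      by (rule nn_integral_distr[symmetric]) (use Rm in auto)
    finally show "(\<integral>\<^sup>+w. g (?R w) * indicator {0..1} t \<partial>lborel) = (\<integral>\<^sup>+w. g w \<partial>lborel) * indicator {0..1} t"
      by (simp add: R)
  qed
  also have "\<dots> = (\<integral>\<^sup>+w. g w \<partial>lborel)" by (subst nn_integral_cmult) auto
  also have "\<dots> = (\<integral>\<^sup>+w. g (w + - z) \<partial>lborel)" by (rule nn_integral_lborel_shift[symmetric]) measurable
  also have "\<dots> = (\<integral>\<^sup>+w. ennreal (indicator (ball z r) w *\<^sub>R (cmod (f w))\<^sup>2) \<partial>lborel)"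
    by (intro nn_integral_cong) (simp add: g_def indicator_def dist_norm norm_minus_commute)
  finally show ?thesis .
qed

section \<open>Inner product, completeness and Riesz representation\<close>

definition sq_norm :: "('n::finite) cvec set \<Rightarrow> ('n cvec \<Rightarrow> complex) \<Rightarrow> real" where
  "sq_norm D f = (LINT z:D|lebesgue. (cmod (f z))\<^sup>2)"

lemma sq_norm_nonneg [simp]: "sq_norm D f \<ge> 0"
  unfolding sq_norm_def set_lebesgue_integral_def by (intro Bochner_Integration.integral_nonneg) auto

lemma berg_norm_eq: "berg_norm D f = sqrt (sq_norm D f)"
  by (simp add: berg_norm_def sq_norm_def)

lemma set_borel_measurable_continuous:
  fixes f :: "'a::euclidean_space \<Rightarrow> 'b::{second_countable_topology, real_normed_vector}"
  assumes "open D" "continuous_on D f"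
  shows "set_borel_measurable lebesgue D f"
proof -
  have "(\<lambda>x. indicator D x *\<^sub>R f x) \<in> borel_measurable borel"
    by (rule borel_measurable_continuous_on_indicator) (use assms in auto)
  then show ?thesis
    unfolding set_borel_measurable_def by (intro measurable_completion) simp
qed

lemma bergman_holo: "f \<in> bergman D \<Longrightarrow> holo_on D f"
  and bergman_integrable: "f \<in> bergman D \<Longrightarrow> set_integrable lebesgue D (\<lambda>z. (cmod (f z))\<^sup>2)"
  by (auto simp: bergman_def)

lemma bergman_continuous: "f \<in> bergman D \<Longrightarrow> continuous_on D f"
  by (simp add: bergman_holo holo_on_continuous_on)

lemma bergman_bound:
  assumes "open D" "holo_on D f" "set_integrable lebesgue D u"
    and "\<And>z. z \<in> D \<Longrightarrow> (cmod (f z))\<^sup>2 \<le> u z"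
  shows "f \<in> bergman D"
proof -
  have "set_integrable lebesgue D (\<lambda>z. (cmod (f z))\<^sup>2)"
    by (rule set_integrable_bound[OF assms(3)])
      (use assms in \<open>auto intro!: set_borel_measurable_continuous continuous_intros holo_on_continuous_on
         AE_I2 order_trans[OF _ abs_ge_self]\<close>)
  then show ?thesis using assms by (simp add: bergman_def)
qed

lemma cmod_add_sq_le: "(cmod (a + b))\<^sup>2 \<le> 2 * (cmod a)\<^sup>2 + 2 * (cmod b)\<^sup>2"
proof -
  have "(cmod (a + b))\<^sup>2 \<le> (cmod a + cmod b)\<^sup>2" by (intro power_mono norm_triangle_ineq) auto
  also have "\<dots> \<le> 2 * (cmod a)\<^sup>2 + 2 * (cmod b)\<^sup>2"
    using sum_squares_bound[of "cmod a" "cmod b"] by (simp add: power2_sum)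
  finally show ?thesis .
qed

lemma bergman_add:
  assumes "open D" "f \<in> bergman D" "g \<in> bergman D" shows "(\<lambda>z. f z + g z) \<in> bergman D"
  using assms
  by (intro bergman_bound[where u = "\<lambda>z. 2 * (cmod (f z))\<^sup>2 + 2 * (cmod (g z))\<^sup>2"] holo_on_add
      set_integral_add(1) set_integrable_mult_right cmod_add_sq_le) (auto simp: bergman_def)

lemma bergman_mult_bounded:
  assumes "open D" "f \<in> bergman D" "holo_on D p" "\<And>z. z \<in> D \<Longrightarrow> cmod (p z) \<le> B"
  shows "(\<lambda>z. p z * f z) \<in> bergman D"
  using assms
  by (intro bergman_bound[where u = "\<lambda>z. B\<^sup>2 * (cmod (f z))\<^sup>2"] holo_on_mult set_integrable_mult_right)
    (auto simp: bergman_def norm_mult power_mult_distrib intro!: mult_right_mono power_mono)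

lemma bergman_cmult:
  assumes "open D" "f \<in> bergman D" shows "(\<lambda>z. c * f z) \<in> bergman D"
  using bergman_mult_bounded[OF assms holo_on_const[of D c], of "cmod c"] by simp

lemma bergman_diff:
  assumes "open D" "f \<in> bergman D" "g \<in> bergman D" shows "(\<lambda>z. f z - g z) \<in> bergman D"
  using bergman_add[OF assms(1,2) bergman_cmult[OF assms(1,3), of "-1"]] by simp

lemma bergman_const:
  assumes "open D" "bounded D" shows "(\<lambda>_. c) \<in> bergman D"
proof -
  have "integrable lebesgue (indicat_real D)"
    using assms emeasure_bounded_finite[OF assms(2)]
    by (simp add: lmeasurable_open fmeasurableD integrable_indicator_iff)
  then show ?thesis
    by (simp add: bergman_def set_integrable_def)
qed

lemma bergman_ip_integrable:
  assumes "open D" "f \<in> bergman D" "g \<in> bergman D"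
  shows "set_integrable lebesgue D (\<lambda>z. f z * cnj (g z))"
proof (rule set_integrable_bound)
  show "set_integrable lebesgue D (\<lambda>z. (cmod (f z))\<^sup>2 + (cmod (g z))\<^sup>2)"
    using assms by (intro set_integral_add(1) bergman_integrable)
  show "set_borel_measurable lebesgue D (\<lambda>z. f z * cnj (g z))"
    using assms by (intro set_borel_measurable_continuous continuous_intros bergman_continuous)
  show "AE z in lebesgue. z \<in> D \<longrightarrow> cmod (f z * cnj (g z)) \<le> norm ((cmod (f z))\<^sup>2 + (cmod (g z))\<^sup>2)"
  proof (intro AE_I2 impI)
    fix z
    have "0 \<le> cmod (f z) * cmod (g z)" by simp
    then have "cmod (f z) * cmod (g z) \<le> (cmod (f z))\<^sup>2 + (cmod (g z))\<^sup>2"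
      using sum_squares_bound[of "cmod (f z)" "cmod (g z)"] by linarith
    then show "cmod (f z * cnj (g z)) \<le> norm ((cmod (f z))\<^sup>2 + (cmod (g z))\<^sup>2)"
      by (simp add: norm_mult)
  qed
qed

lemma berg_ip_cong:
  assumes "\<And>z. z \<in> D \<Longrightarrow> f z = f' z" "\<And>z. z \<in> D \<Longrightarrow> g z = g' z"
  shows "berg_ip D f g = berg_ip D f' g'"
  unfolding berg_ip_def set_lebesgue_integral_def
  by (intro Bochner_Integration.integral_cong) (auto simp: indicator_def assms)

lemma berg_ip_add:
  assumes "open D" "f \<in> bergman D" "g \<in> bergman D" "h \<in> bergman D"
  shows "berg_ip D (\<lambda>z. f z + g z) h = berg_ip D f h + berg_ip D g h"
  unfolding berg_ip_def
  using set_integral_add(2)[OF bergman_ip_integrable[OF assms(1,2,4)] bergman_ip_integrable[OF assms(1,3,4)]]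
  by (simp add: algebra_simps)

lemma berg_ip_cmult: "berg_ip D (\<lambda>z. c * f z) h = c * berg_ip D f h"
  unfolding berg_ip_def by (simp add: mult.assoc)

lemma berg_ip_commute: "berg_ip D g f = cnj (berg_ip D f g)"
  unfolding berg_ip_def set_lebesgue_integral_def
  by (simp flip: Bochner_Integration.integral_cnj add: mult.commute)

lemma berg_ip_cmult_right: "berg_ip D f (\<lambda>z. c * g z) = cnj c * berg_ip D f g"
  by (metis berg_ip_cmult berg_ip_commute complex_cnj_mult)

lemma berg_ip_add_right:
  assumes "open D" "f \<in> bergman D" "g \<in> bergman D" "h \<in> bergman D"
  shows "berg_ip D h (\<lambda>z. f z + g z) = berg_ip D h f + berg_ip D h g"
  by (metis berg_ip_add[OF assms] berg_ip_commute complex_cnj_add)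

lemma berg_ip_self: "berg_ip D f f = of_real (sq_norm D f)"
  unfolding berg_ip_def sq_norm_def set_lebesgue_integral_def
  by (simp flip: integral_complex_of_real complex_norm_square add: scaleR_conv_of_real)

lemma sq_norm_add:
  assumes "open D" "f \<in> bergman D" "g \<in> bergman D"
  shows "sq_norm D (\<lambda>z. f z + c * g z) = sq_norm D f + 2 * Re (cnj c * berg_ip D f g) + (cmod c)\<^sup>2 * sq_norm D g"
proof -
  note cg = bergman_cmult[OF assms(1,3), of c]
  have "of_real (sq_norm D (\<lambda>z. f z + c * g z))
     = berg_ip D f f + cnj c * berg_ip D f g + c * cnj (berg_ip D f g) + c * cnj c * berg_ip D g g"
    using assms cg berg_ip_commute[of D f g]
    by (simp add: berg_ip_self[symmetric] berg_ip_add berg_ip_add_right bergman_add berg_ip_cmult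
        berg_ip_cmult_right algebra_simps)
  then have "Re (of_real (sq_norm D (\<lambda>z. f z + c * g z)))
     = Re (berg_ip D f f + cnj c * berg_ip D f g + c * cnj (berg_ip D f g) + c * cnj c * berg_ip D g g)"
    by simp
  then show ?thesis
    by (simp add: berg_ip_self complex_mult_cnj cmod_power2)
qed

lemma berg_Cauchy_Schwarz:
  assumes "open D" "f \<in> bergman D" "g \<in> bergman D"
  shows "(cmod (berg_ip D f g))\<^sup>2 \<le> sq_norm D f * sq_norm D g"
proof -
  let ?c = "berg_ip D f g"
  \<comment> \<open>The squared norm of \<open>f - s * ?c * g\<close> for real \<open>s\<close>; if
    \<open>sq_norm D g > 0\<close>, this quadratic is smallest at
    \<open>s = 1 / sq_norm D g\<close>.\<close>
  have *: "0 \<le> sq_norm D f - 2 * s * (cmod ?c)\<^sup>2 + s\<^sup>2 * (cmod ?c)\<^sup>2 * sq_norm D g" for s :: real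
  proof -
    have "0 \<le> sq_norm D (\<lambda>z. f z + (- of_real s * ?c) * g z)" by simp
    also have "\<dots> = sq_norm D f + 2 * Re (cnj (- of_real s * ?c) * ?c) + (cmod (- of_real s * ?c))\<^sup>2 * sq_norm D g"
      by (rule sq_norm_add[OF assms])
    also have "Re (cnj (- of_real s * ?c) * ?c) = - s * (cmod ?c)\<^sup>2"
    proof -
      have "cnj (- of_real s * ?c) * ?c = of_real (- s * (cmod ?c)\<^sup>2)"
        unfolding of_real_mult complex_norm_square by (simp add: ac_simps)
      then have "Re (cnj (- of_real s * ?c) * ?c) = Re (of_real (- s * (cmod ?c)\<^sup>2))" by (rule arg_cong)
      then show ?thesis by (simp only: Re_complex_of_real)
    qed
    finally show ?thesis by (simp add: norm_mult power_mult_distrib)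
  qed
  show ?thesis
  proof (cases "sq_norm D g = 0")
    case True
    have "?c = 0"
    proof (rule ccontr)
      assume "?c \<noteq> 0"
      \<comment> \<open>With \<open>sq_norm D g = 0\<close> the bound is affine in \<open>s\<close>,
        and this \<open>s\<close> makes its right side \<open>-1\<close>.\<close>
      then show False using *[of "(sq_norm D f + 1) / (2 * (cmod ?c)\<^sup>2)"] True by simp
    qed
    then show ?thesis by simp
  next
    case False
    then have pos: "sq_norm D g > 0" using sq_norm_nonneg[of D g] by linarith
    have "0 \<le> sq_norm D f - (cmod ?c)\<^sup>2 / sq_norm D g"
      using *[of "1 / sq_norm D g"] pos by (simp add: power2_eq_square)
    then show ?thesis using pos by (simp add: field_simps)
  qed
qed

lemma sq_norm_nn_integral:
  assumes "f \<in> bergman D"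
  shows "(\<integral>\<^sup>+z. ennreal (indicator D z *\<^sub>R (cmod (f z))\<^sup>2) \<partial>lebesgue) = ennreal (sq_norm D f)"
  using bergman_integrable[OF assms] unfolding sq_norm_def set_lebesgue_integral_def set_integrable_def
  by (intro nn_integral_eq_integral) auto

text \<open>Makes point evaluations bounded, with a constant depending only on the radius of a ball
  that fits into \<open>D\<close>. Convergence in norm therefore forces locally uniform
  convergence.\<close>

lemma bergman_point_bound:
  fixes z :: "'n::finite cvec"
  assumes f: "f \<in> bergman D" and r: "r > 0" "ball z r \<subseteq> D"
  shows "(cmod (f z))\<^sup>2 \<le> sq_norm D f / measure lborel (ball (0::'n cvec) r)"
proof -
  let ?B = "ball (0::'n cvec) r"
  have fin: "emeasure lborel ?B = ennreal (measure lborel ?B)"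
    by (rule emeasure_eq_ennreal_measure) (use emeasure_bounded_finite[of ?B] in auto)
  have "open ?B" "?B \<noteq> {}" using r by auto
  then have pos: "measure lborel ?B > 0"
    using open_not_negligible[of ?B]
    by (metis negligible_iff_measure0 lmeasurable_ball measure_completion measure_nonneg order_le_less
        fmeasurableD borel_open sets_lborel)
  have "ennreal ((cmod (f z))\<^sup>2) * emeasure lborel ?B
      \<le> (\<integral>\<^sup>+w. ennreal (indicator (ball z r) w *\<^sub>R (cmod (f w))\<^sup>2) \<partial>lborel)"
    using holo_on_subset[OF bergman_holo[OF f] r(2)] r(1) by (rule holo_sub_mean_value)
  also have "\<dots> \<le> (\<integral>\<^sup>+w. ennreal (indicator D w *\<^sub>R (cmod (f w))\<^sup>2) \<partial>lborel)"
    using r by (intro nn_integral_mono ennreal_leI) (auto simp: indicator_def)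
  also have "\<dots> = ennreal (sq_norm D f)"
    using sq_norm_nn_integral[OF f] by (simp add: nn_integral_completion)
  finally have "(cmod (f z))\<^sup>2 * measure lborel ?B \<le> sq_norm D f"
    by (simp add: fin ennreal_mult[symmetric])
  then show ?thesis using pos by (simp add: field_simps)
qed

text \<open>By the point bound a Cauchy sequence is uniformly Cauchy near every point, so the
  pointwise limit \<open>h\<close> is holomorphic. Fatou's lemma, with \<open>n\<close> fixed and
  \<open>m\<close> tending to infinity, gives square integrability of \<open>f n - h\<close> and
  convergence in norm.\<close>

lemma bergman_complete:
  fixes D :: "'n::finite cvec set"
  assumes D: "open D" and f: "\<And>n. f n \<in> bergman D"
    and Cauchy: "\<And>e. e > 0 \<Longrightarrow> \<exists>N. \<forall>m\<ge>N. \<forall>n\<ge>N. sq_norm D (\<lambda>z. f m z - f n z) < e"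
  shows "\<exists>h\<in>bergman D. (\<lambda>n. sq_norm D (\<lambda>z. f n z - h z)) \<longlonglongrightarrow> 0"
proof -
  define h where "h z = lim (\<lambda>n. f n z)" for z
  have unif: "\<exists>r>0. ball z r \<subseteq> D \<and> uniform_limit (ball z r) f h sequentially" if zD: "z \<in> D" for z
  proof -
    obtain R where R: "R > 0" "ball z R \<subseteq> D" using D zD open_contains_ball by metis
    let ?r = "R/2"
    let ?V = "measure lborel (ball (0::'n cvec) ?r)"
    \<comment> \<open>If \<open>?V\<close> were 0, the quotient in the point bound for the constant
      1 would be 0 by the convention for division by zero, and \<open>1 \<le> 0\<close> would
      follow.\<close>
    have V: "?V > 0"
      using bergman_point_bound[OF bergman_const[of "ball (0::'n cvec) ?r" 1], of ?r 0] R
      by (cases "?V = 0") (auto simp: zero_less_measure_iff)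
    have bd: "(cmod (f m w - f n w))\<^sup>2 \<le> sq_norm D (\<lambda>z. f m z - f n z) / ?V" if w: "w \<in> ball z ?r" for m n w
    proof (rule bergman_point_bound[OF bergman_diff[OF D f f]])
      have "ball w ?r \<subseteq> ball z R"
        using w by (intro ball_subset_ball_iff[THEN iffD2]) (auto simp: dist_commute field_simps)
      then show "ball w ?r \<subseteq> D" using R by blast
    qed (use R in auto)
    have "uniformly_Cauchy_on (ball z ?r) f"
      unfolding uniformly_Cauchy_on_def
    proof (intro allI impI)
      fix e :: real assume "e > 0"
      then obtain N where N: "\<forall>m\<ge>N. \<forall>n\<ge>N. sq_norm D (\<lambda>z. f m z - f n z) < e\<^sup>2 * ?V"
        using Cauchy[of "e\<^sup>2 * ?V"] V by auto
      show "\<exists>M. \<forall>x\<in>ball z ?r. \<forall>m\<ge>M. \<forall>n\<ge>M. dist (f m x) (f n x) < e"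
      proof (intro exI[of _ N] ballI allI impI)
        fix x m n assume *: "x \<in> ball z ?r" "N \<le> m" "N \<le> n"
        then have "(cmod (f m x - f n x))\<^sup>2 * ?V \<le> sq_norm D (\<lambda>z. f m z - f n z)"
          using bd[of x m n] V by (simp add: field_simps)
        also have "\<dots> < e\<^sup>2 * ?V" using N * by blast
        finally have "(cmod (f m x - f n x))\<^sup>2 < e\<^sup>2" using V by simp
        then show "dist (f m x) (f n x) < e"
          using \<open>e > 0\<close> by (simp add: dist_norm power_less_imp_less_base)
      qed
    qed
    then have "uniform_limit (ball z ?r) f h sequentially"
      unfolding h_def using Cauchy_uniformly_convergent uniformly_convergent_uniform_limit_iff by blast
    moreover have "ball z ?r \<subseteq> D" "?r > 0" using R by auto
    ultimately show ?thesis by blast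
  qed
  have holo: "holo_on D h"
    unfolding holo_on_def
  proof
    fix z assume "z \<in> D"
    then obtain r where "r > 0" "ball z r \<subseteq> D" "uniform_limit (ball z r) f h sequentially"
      using unif by blast
    then show "\<exists>L. (h has_derivative L) (at z) \<and> (\<forall>c v. L (c *s v) = c * L v)"
      using holo_on_subset[OF bergman_holo[OF f]] by (intro holo_uniform_limit_at[of z r f]) auto
  qed
  have lim: "(\<lambda>n. f n z) \<longlonglongrightarrow> h z" if zD: "z \<in> D" for z
  proof -
    obtain r where r: "r > 0" "uniform_limit (ball z r) f h sequentially" using unif[OF zD] by blast
    then have "z \<in> ball z r" by simp
    from tendsto_uniform_limitI[OF r(2) this] show ?thesis .
  qed
  have Fatou: "(\<integral>\<^sup>+z. ennreal (indicator D z *\<^sub>R (cmod (f n z - h z))\<^sup>2) \<partial>lebesgue) \<le> ennreal e"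
    if N: "\<forall>m\<ge>N. \<forall>n\<ge>N. sq_norm D (\<lambda>z. f m z - f n z) < e" and n: "n \<ge> N" for n N e
  proof -
    let ?u = "\<lambda>m z. ennreal (indicator D z *\<^sub>R (cmod (f n z - f m z))\<^sup>2)"
    have "(\<integral>\<^sup>+z. ennreal (indicator D z *\<^sub>R (cmod (f n z - h z))\<^sup>2) \<partial>lebesgue)
        = (\<integral>\<^sup>+z. liminf (\<lambda>m. ?u m z) \<partial>lebesgue)"
    proof (rule nn_integral_cong)
      fix z :: "'n cvec"
      have "(\<lambda>m. ?u m z) \<longlonglongrightarrow> ennreal (indicator D z *\<^sub>R (cmod (f n z - h z))\<^sup>2)"
      proof (cases "z \<in> D")
        case True
        then show ?thesis using lim by (intro tendsto_ennrealI tendsto_intros)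
      qed simp
      then show "ennreal (indicator D z *\<^sub>R (cmod (f n z - h z))\<^sup>2) = liminf (\<lambda>m. ?u m z)"
        using lim_imp_Liminf[OF sequentially_bot] by metis
    qed
    also have "\<dots> \<le> liminf (\<lambda>m. \<integral>\<^sup>+z. ?u m z \<partial>lebesgue)"
    proof (rule nn_integral_liminf)
      fix m
      have "set_borel_measurable lebesgue D (\<lambda>z. (cmod (f n z - f m z))\<^sup>2)"
        using D f by (intro set_borel_measurable_continuous continuous_intros bergman_continuous)
      then show "?u m \<in> borel_measurable lebesgue" unfolding set_borel_measurable_def by measurable
    qed
    also have "\<dots> \<le> liminf (\<lambda>m::nat. ennreal e)"
    proof (rule Liminf_mono)
      have "(\<integral>\<^sup>+z. ?u m z \<partial>lebesgue) \<le> ennreal e" if "m \<ge> N" for m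
      proof -
        have "(\<integral>\<^sup>+z. ?u m z \<partial>lebesgue) = ennreal (sq_norm D (\<lambda>z. f n z - f m z))"
          by (rule sq_norm_nn_integral[OF bergman_diff[OF D f f]])
        also have "\<dots> \<le> ennreal e" using N n that by (intro ennreal_leI) (auto simp: less_imp_le)
        finally show ?thesis .
      qed
      then show "\<forall>\<^sub>F m in sequentially. (\<integral>\<^sup>+z. ?u m z \<partial>lebesgue) \<le> ennreal e"
        unfolding eventually_sequentially by blast
    qed
    also have "\<dots> = ennreal e" by (simp add: Liminf_const)
    finally show ?thesis .
  qed
  have diff: "(\<lambda>z. f n z - h z) \<in> bergman D"
    if N: "\<forall>m\<ge>N. \<forall>n\<ge>N. sq_norm D (\<lambda>z. f m z - f n z) < e" and n: "n \<ge> N" for n N e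
  proof -
    have hd: "holo_on D (\<lambda>z. f n z - h z)" using holo bergman_holo[OF f] by (intro holo_on_diff)
    have "set_borel_measurable lebesgue D (\<lambda>z. (cmod (f n z - h z))\<^sup>2)"
      using D by (intro set_borel_measurable_continuous continuous_intros bergman_continuous f
          holo_on_continuous_on[OF holo])
    then have "set_integrable lebesgue D (\<lambda>z. (cmod (f n z - h z))\<^sup>2)"
      unfolding set_integrable_def set_borel_measurable_def
      using le_less_trans[OF Fatou[OF N n] ennreal_less_top] by (intro integrableI_nonneg) auto
    then show ?thesis using hd by (simp add: bergman_def)
  qed
  \<comment> \<open>\<open>h\<close> is recovered as \<open>f N - (f N - h)\<close>.\<close>
  have "h \<in> bergman D"
  proof -
    obtain N where "\<forall>m\<ge>N. \<forall>n\<ge>N. sq_norm D (\<lambda>z. f m z - f n z) < 1" using Cauchy[of 1] by auto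
    from bergman_diff[OF D f diff[OF this order_refl], of N]
    show ?thesis by simp
  qed
  moreover have "(\<lambda>n. sq_norm D (\<lambda>z. f n z - h z)) \<longlonglongrightarrow> 0"
  proof (rule LIMSEQ_I)
    fix e :: real assume e: "e > 0"
    then obtain N where N: "\<forall>m\<ge>N. \<forall>n\<ge>N. sq_norm D (\<lambda>z. f m z - f n z) < e/2"
      using Cauchy[of "e/2"] by auto
    have "sq_norm D (\<lambda>z. f n z - h z) < e" if n: "n \<ge> N" for n
    proof -
      have "ennreal (sq_norm D (\<lambda>z. f n z - h z)) \<le> ennreal (e/2)"
        using Fatou[OF N n] sq_norm_nn_integral[OF diff[OF N n]] by simp
      then show ?thesis using e by (simp add: ennreal_le_iff)
    qed
    then show "\<exists>N. \<forall>n\<ge>N. norm (sq_norm D (\<lambda>z. f n z - h z) - 0) < e" by auto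
  qed
  ultimately show ?thesis by blast
qed

lemma quadratic_nonneg_imp_zero:
  fixes a b :: real
  assumes "\<And>t. 0 \<le> 2 * t * a + t\<^sup>2 * b" and "b \<ge> 0"
  shows "a = 0"
proof (rule ccontr)
  assume "a \<noteq> 0"
  \<comment> \<open>The minimiser \<open>- a / b\<close> with \<open>b + 1\<close> in place of
    \<open>b\<close>, which also covers \<open>b = 0\<close>.\<close>
  have "0 \<le> 2 * (- a / (b + 1)) * a + (- a / (b + 1))\<^sup>2 * b" by (rule assms(1))
  also have "\<dots> = - (a\<^sup>2 * (b + 2)) / (b + 1)\<^sup>2"
    using \<open>b \<ge> 0\<close> by (simp add: power2_eq_square divide_simps) (simp add: algebra_simps)
  also have "\<dots> < 0" using \<open>a \<noteq> 0\<close> \<open>b \<ge> 0\<close> by (intro divide_neg_pos) auto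
  finally show False by simp
qed

text \<open>The representing vector minimises \<open>sq_norm f - 2 * Re (l f)\<close>.\<close>

lemma bergman_Riesz:
  assumes D: "open D"
    and add: "\<And>f g. f \<in> bergman D \<Longrightarrow> g \<in> bergman D \<Longrightarrow> l (\<lambda>z. f z + g z) = l f + l g"
    and scale: "\<And>c f. f \<in> bergman D \<Longrightarrow> l (\<lambda>z. c * f z) = c * l f"
    and bound: "\<And>f. f \<in> bergman D \<Longrightarrow> cmod (l f) \<le> C * berg_norm D f"
  shows "\<exists>h\<in>bergman D. \<forall>f\<in>bergman D. l f = berg_ip D f h"
proof -
  define E where "E f = sq_norm D f - 2 * Re (l f)" for f
  have zero: "(\<lambda>_. 0) \<in> bergman D" by (simp add: bergman_def set_integrable_def)
  \<comment> \<open>Completing the square: \<open>sq_norm D f - 2 * C * berg_norm D f\<close> is at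
    least \<open>- C\<^sup>2\<close>.\<close>
  have E_bd: "- C\<^sup>2 \<le> E f" if "f \<in> bergman D" for f
  proof -
    have "Re (l f) \<le> C * berg_norm D f"
      using bound[OF that] complex_Re_le_cmod[of "l f"] by linarith
    moreover have "0 \<le> (berg_norm D f - C)\<^sup>2" by simp
    moreover have "sq_norm D f = (berg_norm D f)\<^sup>2" by (simp add: berg_norm_eq)
    ultimately show ?thesis unfolding E_def by (simp add: power2_diff algebra_simps)
  qed
  define I where "I = Inf (E ` bergman D)"
  have bdd: "bdd_below (E ` bergman D)" using E_bd by (auto simp: bdd_below_def)
  have I_le: "I \<le> E f" if "f \<in> bergman D" for f
    unfolding I_def using that by (intro cInf_lower bdd) auto
  have "\<exists>f\<in>bergman D. E f < I + 1 / real (Suc n)" for n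
  proof -
    have "Inf (E ` bergman D) < I + 1 / real (Suc n)" unfolding I_def by simp
    then show ?thesis using cInf_lessD[of "E ` bergman D"] zero by blast
  qed
  then obtain f where f: "\<And>n. f n \<in> bergman D" and Ef: "\<And>n. E (f n) < I + 1 / real (Suc n)"
    by metis
  have E_add: "E (\<lambda>z. u z + c * v z) = E u + 2 * Re (cnj c * berg_ip D u v) - 2 * Re (c * l v) + (cmod c)\<^sup>2 * sq_norm D v"
    if "u \<in> bergman D" "v \<in> bergman D" for u v c
    unfolding E_def sq_norm_add[OF D that] add[OF that(1) bergman_cmult[OF D that(2)]] scale[OF that(2)]
    by (simp add: algebra_simps)
  \<comment> \<open>Parallelogram argument: \<open>E\<close> at the midpoint
    \<open>f n + ?d / 2\<close> is at least \<open>I\<close>, while \<open>E (f n)\<close> and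
    \<open>E (f m)\<close> barely exceed \<open>I\<close>; eliminating the linear terms bounds the
    quadratic one.\<close>
  have par: "sq_norm D (\<lambda>z. f m z - f n z) \<le> 2 / real (Suc m) + 2 / real (Suc n)" for m n
  proof -
    let ?d = "\<lambda>z. f m z - f n z"
    have d: "?d \<in> bergman D" by (rule bergman_diff[OF D f f])
    have "(\<lambda>z. f n z + 1 * ?d z) = f m" by auto
    then have 1: "E (f m) = E (f n) + 2 * Re (berg_ip D (f n) ?d) - 2 * Re (l ?d) + sq_norm D ?d"
      using E_add[OF f d, of n 1] by simp
    have 2: "I \<le> E (f n) + Re (berg_ip D (f n) ?d) - Re (l ?d) + sq_norm D ?d / 4"
      using I_le[OF bergman_add[OF D f bergman_cmult[OF D d, of "1/2"]], of n] E_add[OF f d, of n "1/2"]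
      by (simp add: power2_eq_square norm_divide)
    have "2 / real (Suc k) = 2 * (1 / real (Suc k))" for k by simp
    then show ?thesis using 1 2 Ef[of m] Ef[of n] by linarith
  qed
  have "\<exists>h\<in>bergman D. (\<lambda>n. sq_norm D (\<lambda>z. f n z - h z)) \<longlonglongrightarrow> 0"
  proof (rule bergman_complete[OF D f])
    fix e :: real assume e: "e > 0"
    then obtain N where N: "4 / e < real N" using reals_Archimedean2 by blast
    have *: "2 / real (Suc n) < e / 2" if "n \<ge> N" for n
    proof -
      have "4 / e < real (Suc n)" using N that by linarith
      then show ?thesis using e by (simp add: field_simps)
    qed
    show "\<exists>N. \<forall>m\<ge>N. \<forall>n\<ge>N. sq_norm D (\<lambda>z. f m z - f n z) < e"
    proof (intro exI[of _ N] allI impI)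
      fix m n assume "N \<le> m" "N \<le> n"
      then show "sq_norm D (\<lambda>z. f m z - f n z) < e" using par[of m n] *[of m] *[of n] by linarith
    qed
  qed
  then obtain h where h: "h \<in> bergman D" and lim: "(\<lambda>n. sq_norm D (\<lambda>z. f n z - h z)) \<longlonglongrightarrow> 0" by blast
  \<comment> \<open>First variation. The infimum bounds \<open>E (f n + t * g)\<close> from below
    for every \<open>n\<close>, so the inequality at \<open>h\<close> comes from letting
    \<open>n\<close> grow, without evaluating \<open>E\<close> at \<open>h\<close>.\<close>
  have Re_eq: "Re (berg_ip D h g) = Re (l g)" if g: "g \<in> bergman D" for g
  proof -
    have ip_lim: "(\<lambda>n. berg_ip D (f n) g) \<longlonglongrightarrow> berg_ip D h g"
    proof -
      have eq: "berg_ip D (f n) g - berg_ip D h g = berg_ip D (\<lambda>z. f n z - h z) g" for n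
        using berg_ip_add[OF D bergman_diff[OF D f h] h g, of n] by simp
      have "(\<lambda>n. sq_norm D (\<lambda>z. f n z - h z) * sq_norm D g) \<longlonglongrightarrow> 0 * sq_norm D g"
        by (intro tendsto_intros lim)
      then have "(\<lambda>n. sqrt (sq_norm D (\<lambda>z. f n z - h z) * sq_norm D g)) \<longlonglongrightarrow> sqrt 0"
        by (intro tendsto_real_sqrt) simp
      then have lim0: "(\<lambda>n. sqrt (sq_norm D (\<lambda>z. f n z - h z) * sq_norm D g)) \<longlonglongrightarrow> 0" by simp
      have "(\<lambda>n. berg_ip D (f n) g - berg_ip D h g) \<longlonglongrightarrow> 0"
      proof (rule Lim_null_comparison[OF always_eventually lim0], rule allI)
        fix n
        show "norm (berg_ip D (f n) g - berg_ip D h g) \<le> sqrt (sq_norm D (\<lambda>z. f n z - h z) * sq_norm D g)"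
          unfolding eq using berg_Cauchy_Schwarz[OF D bergman_diff[OF D f h] g] real_le_rsqrt by blast
      qed
      then show ?thesis by (simp add: LIM_zero_iff)
    qed
    have "0 \<le> 2 * t * (Re (berg_ip D h g) - Re (l g)) + t\<^sup>2 * sq_norm D g" for t
    proof (rule tendsto_lowerbound[where F=sequentially])
      have "(\<lambda>n. 1 / real (Suc n)) \<longlonglongrightarrow> 0" using LIMSEQ_inverse_real_of_nat by (simp add: inverse_eq_divide)
      from tendsto_add[OF this tendsto_add[OF tendsto_mult[OF tendsto_const tendsto_diff[OF tendsto_Re[OF ip_lim] tendsto_const]] tendsto_const]]
      show "(\<lambda>n. 1 / real (Suc n) + (2 * t * (Re (berg_ip D (f n) g) - Re (l g)) + t\<^sup>2 * sq_norm D g))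
        \<longlonglongrightarrow> 2 * t * (Re (berg_ip D h g) - Re (l g)) + t\<^sup>2 * sq_norm D g" by simp
      show "\<forall>\<^sub>F n in sequentially. 0 \<le> 1 / real (Suc n) + (2 * t * (Re (berg_ip D (f n) g) - Re (l g)) + t\<^sup>2 * sq_norm D g)"
      proof (rule always_eventually, rule allI)
        fix n
        have "I \<le> E (f n) + 2 * Re (of_real t * berg_ip D (f n) g) - 2 * Re (of_real t * l g) + t\<^sup>2 * sq_norm D g"
          using I_le[OF bergman_add[OF D f bergman_cmult[OF D g, of "of_real t"]], of n] E_add[OF f g, of n "of_real t"]
          by simp
        then show "0 \<le> 1 / real (Suc n) + (2 * t * (Re (berg_ip D (f n) g) - Re (l g)) + t\<^sup>2 * sq_norm D g)"
          using Ef[of n] by (simp add: algebra_simps)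
      qed
    qed simp
    then have "Re (berg_ip D h g) - Re (l g) = 0" by (rule quadratic_nonneg_imp_zero) simp
    then show ?thesis by simp
  qed
  have "l g = berg_ip D g h" if g: "g \<in> bergman D" for g
  proof -
    \<comment> \<open>Replacing \<open>g\<close> by \<open>\<i> * g\<close> turns the identity of
      real parts into one of imaginary parts.\<close>
    have "Re (berg_ip D h (\<lambda>z. \<i> * g z)) = Re (l (\<lambda>z. \<i> * g z))" by (rule Re_eq[OF bergman_cmult[OF D g]])
    then have "Im (berg_ip D h g) = - Im (l g)" using g by (simp add: berg_ip_cmult_right scale)
    then have "l g = cnj (berg_ip D h g)" using Re_eq[OF g] by (simp add: complex_eq_iff)
    then show ?thesis using berg_ip_commute[of D g h] by simp
  qed
  then show ?thesis using h by blast
qed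

section \<open>The commutant on a domain with a univalent fibre\<close>

text \<open>Built by one coordinate factor at a time, so that an induction uses one commutation
  relation with a coordinate multiplication operator per step.\<close>

inductive cpoly :: "(('n::finite) cvec \<Rightarrow> complex) \<Rightarrow> bool" where
  const: "cpoly (\<lambda>_. c)"
| add: "cpoly p \<Longrightarrow> cpoly q \<Longrightarrow> cpoly (\<lambda>y. p y + q y)"
| coord: "cpoly p \<Longrightarrow> cpoly (\<lambda>y. y $ j * p y)"

lemma cpoly_mult: "cpoly p \<Longrightarrow> cpoly q \<Longrightarrow> cpoly (\<lambda>y. p y * q y)"
proof (induction p rule: cpoly.induct)
  case (const c)
  from const show ?case
  proof (induction q rule: cpoly.induct)
    case (const d)
    show ?case by (rule cpoly.const[of "c * d"])
  next
    case (add p q)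
    then show ?case using cpoly.add[of "\<lambda>y. c * p y" "\<lambda>y. c * q y"] by (simp add: distrib_left)
  next
    case (coord p j)
    then show ?case using cpoly.coord[of "\<lambda>y. c * p y" j] by (simp add: mult.left_commute)
  qed
next
  case (add p p')
  then show ?case using cpoly.add[of "\<lambda>y. p y * q y" "\<lambda>y. p' y * q y"] by (simp add: distrib_right)
next
  case (coord p j)
  then show ?case using cpoly.coord[of "\<lambda>y. p y * q y" j] by (simp add: mult.assoc)
qed

text \<open>Sums of products \<open>p * cnj q\<close> have exactly the shape to which the moment
  identity applies, and they form an algebra containing all real polynomials in the real and
  imaginary parts.\<close>

inductive cpoly2 :: "(('n::finite) cvec \<Rightarrow> complex) \<Rightarrow> bool" where
  base: "cpoly p \<Longrightarrow> cpoly q \<Longrightarrow> cpoly2 (\<lambda>y. p y * cnj (q y))"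
| add: "cpoly2 u \<Longrightarrow> cpoly2 v \<Longrightarrow> cpoly2 (\<lambda>y. u y + v y)"

lemma cpoly2_const: "cpoly2 (\<lambda>_. c)"
  using cpoly2.base[OF cpoly.const[of c] cpoly.const[of 1]] by simp

lemma cpoly2_mult: "cpoly2 u \<Longrightarrow> cpoly2 v \<Longrightarrow> cpoly2 (\<lambda>y. u y * v y)"
proof (induction u rule: cpoly2.induct)
  case (base p q)
  note pq = base(1,2)
  from base(3) show ?case
  proof (induction v rule: cpoly2.induct)
    case (base p' q')
    show ?case
      using cpoly2.base[OF cpoly_mult[OF pq(1) base(1)] cpoly_mult[OF pq(2) base(2)]]
      by (simp add: ac_simps)
  next
    case (add u v)
    then show ?case
      using cpoly2.add[of "\<lambda>y. p y * cnj (q y) * u y" "\<lambda>y. p y * cnj (q y) * v y"] by (simp add: distrib_left)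
  qed
next
  case (add u u')
  then show ?case using cpoly2.add[of "\<lambda>y. u y * v y" "\<lambda>y. u' y * v y"] by (simp add: distrib_right)
qed

lemma cpoly2_sum: "(\<And>i. i \<in> I \<Longrightarrow> cpoly2 (u i)) \<Longrightarrow> cpoly2 (\<lambda>y. \<Sum>i\<in>I. u i y)"
  by (induction I rule: infinite_finite_induct) (auto intro: cpoly2.add cpoly2_const)

lemma cpoly2_Re: "cpoly2 (\<lambda>y. of_real (Re (y $ j)))" and cpoly2_Im: "cpoly2 (\<lambda>y. of_real (Im (y $ j)))"
proof -
  have c: "cpoly2 (\<lambda>y. y $ j)"
    using cpoly2.base[OF cpoly.coord[OF cpoly.const[of 1]] cpoly.const[of 1]] by simp
  have cc: "cpoly2 (\<lambda>y. cnj (y $ j))"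
    using cpoly2.base[OF cpoly.const[of 1] cpoly.coord[OF cpoly.const[of 1]]] by simp
  have eqs: "of_real (Re z) = (1/2) * (z + cnj z)" "of_real (Im z) = (- \<i>/2) * (z + (-1) * cnj z)" for z
    by (simp_all add: complex_eq_iff)
  show "cpoly2 (\<lambda>y. of_real (Re (y $ j)))" "cpoly2 (\<lambda>y. of_real (Im (y $ j)))"
    unfolding eqs by (intro cpoly2_mult cpoly2.add cpoly2_const c cc)+
qed

text \<open>Connects the real Stone-Weierstrass theorem with \<open>cpoly2\<close>: a real linear
  functional combines the \<open>Re (y $ j)\<close> and \<open>Im (y $ j)\<close>, and these combine
  \<open>y $ j\<close> with its conjugate.\<close>

lemma real_polynomial_function_cpoly2:
  fixes g :: "'n::finite cvec \<Rightarrow> real"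
  shows "real_polynomial_function g \<Longrightarrow> cpoly2 (\<lambda>y. of_real (g y))"
proof (induction g rule: real_polynomial_function.induct)
  case (linear f)
  have expand: "f y = (\<Sum>j\<in>UNIV. Re (y $ j) * f (axis j 1) + Im (y $ j) * f (axis j \<i>))" for y
  proof -
    have "y = (\<Sum>j\<in>UNIV. Re (y $ j) *\<^sub>R axis j 1 + Im (y $ j) *\<^sub>R axis j \<i>)"
    proof -
      have "Re (y $ j) *\<^sub>R axis j 1 + Im (y $ j) *\<^sub>R axis j \<i> = (y $ j) *s axis j 1" for j
        by (auto simp: vec_eq_iff axis_def complex_eq_iff)
      then show ?thesis by (simp only: basis_expansion)
    qed
    then have "f y = f (\<Sum>j\<in>UNIV. Re (y $ j) *\<^sub>R axis j 1 + Im (y $ j) *\<^sub>R axis j \<i>)" by simp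
    then show ?thesis
      using linear by (simp add: linear_sum linear_add linear_cmul bounded_linear.linear)
  qed
  have "cpoly2 (\<lambda>y. \<Sum>j\<in>UNIV. of_real (Re (y $ j)) * of_real (f (axis j 1)) + of_real (Im (y $ j)) * of_real (f (axis j \<i>)))"
    by (intro cpoly2_sum cpoly2.add cpoly2_mult cpoly2_const cpoly2_Re cpoly2_Im)
  moreover have "(\<lambda>y. complex_of_real (f y)) = (\<lambda>y. \<Sum>j\<in>UNIV. of_real (Re (y $ j)) * of_real (f (axis j 1))
      + of_real (Im (y $ j)) * of_real (f (axis j \<i>)))"
    by (rule ext, subst expand) simp
  ultimately show ?case by argo
next
  case (const c)
  show ?case by (rule cpoly2_const)
next
  case (add f g)
  then show ?case unfolding of_real_add by (intro cpoly2.add)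
next
  case (mult f g)
  then show ?case unfolding of_real_mult by (intro cpoly2_mult)
qed

section \<open>Adjoints and vanishing moments\<close>

text \<open>Gives content to the adjoint clause of \<open>Vstar\<close>. For each \<open>g\<close>
  the functional \<open>f \<mapsto> <\<phi> f, g>\<close> is bounded, and its Riesz vector is taken
  as \<open>S g\<close>.\<close>

lemma mult_op_adjoint_exists:
  assumes D: "open D" and \<phi>: "holo_on D \<phi>" "\<And>z. z \<in> D \<Longrightarrow> cmod (\<phi> z) \<le> B"
  shows "\<exists>S. is_adjoint D (mult_op \<phi>) S"
proof -
  have mem: "mult_op \<phi> f \<in> bergman D" if "f \<in> bergman D" for f
    unfolding mult_op_def using bergman_mult_bounded[OF D that \<phi>] .
  have norm_le: "berg_norm D (mult_op \<phi> f) \<le> \<bar>B\<bar> * berg_norm D f" if f: "f \<in> bergman D" for f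
  proof -
    have "sq_norm D (mult_op \<phi> f) \<le> (LINT z:D|lebesgue. B\<^sup>2 * (cmod (f z))\<^sup>2)"
      unfolding sq_norm_def
    proof (rule set_integral_mono)
      fix z assume "z \<in> D"
      then have "(cmod (\<phi> z))\<^sup>2 \<le> B\<^sup>2" by (intro power_mono \<phi>) auto
      then show "(cmod (mult_op \<phi> f z))\<^sup>2 \<le> B\<^sup>2 * (cmod (f z))\<^sup>2"
        by (simp add: mult_op_def norm_mult power_mult_distrib mult_right_mono)
    qed (use bergman_integrable[OF mem[OF f]] bergman_integrable[OF f] in auto)
    also have "\<dots> = B\<^sup>2 * sq_norm D f" by (simp add: sq_norm_def)
    finally have "sqrt (sq_norm D (mult_op \<phi> f)) \<le> sqrt (B\<^sup>2 * sq_norm D f)" by simp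
    then show ?thesis by (simp add: berg_norm_eq real_sqrt_mult)
  qed
  have "\<exists>h\<in>bergman D. \<forall>f\<in>bergman D. berg_ip D (mult_op \<phi> f) g = berg_ip D f h" if g: "g \<in> bergman D" for g
  proof (rule bergman_Riesz[OF D, where C = "\<bar>B\<bar> * berg_norm D g"])
    fix f f' assume "f \<in> bergman D" "f' \<in> bergman D"
    then show "berg_ip D (mult_op \<phi> (\<lambda>z. f z + f' z)) g = berg_ip D (mult_op \<phi> f) g + berg_ip D (mult_op \<phi> f') g"
      using berg_ip_add[OF D mem mem g, of f f'] by (simp add: mult_op_def distrib_left)
  next
    fix f c assume "f \<in> bergman D"
    show "berg_ip D (mult_op \<phi> (\<lambda>z. c * f z)) g = c * berg_ip D (mult_op \<phi> f) g"
      using berg_ip_cmult[of D c "mult_op \<phi> f" g] by (simp add: mult_op_def mult.left_commute)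
  next
    fix f assume f: "f \<in> bergman D"
    have "cmod (berg_ip D (mult_op \<phi> f) g) \<le> berg_norm D (mult_op \<phi> f) * berg_norm D g"
      using berg_Cauchy_Schwarz[OF D mem[OF f] g]
      by (simp add: berg_norm_eq real_sqrt_mult[symmetric] real_le_rsqrt)
    also have "\<dots> \<le> (\<bar>B\<bar> * berg_norm D f) * berg_norm D g"
      by (intro mult_right_mono norm_le f) (simp add: berg_norm_eq)
    finally show "cmod (berg_ip D (mult_op \<phi> f) g) \<le> \<bar>B\<bar> * berg_norm D g * berg_norm D f"
      by (simp add: ac_simps)
  qed
  then show ?thesis unfolding is_adjoint_def by metis
qed

text \<open>For \<open>g = 1\<close> this supplies \<open>T\<^sup>*1\<close>. Linearity of
  \<open>T\<close> is available only pointwise on \<open>D\<close>, hence the use of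
  \<open>berg_ip_cong\<close>.\<close>

lemma bdd_op_riesz:
  assumes D: "open D" and T: "bdd_op D T" and g: "g \<in> bergman D"
  shows "\<exists>h\<in>bergman D. \<forall>f\<in>bergman D. berg_ip D (T f) g = berg_ip D f h"
proof -
  have mem: "T f \<in> bergman D" if "f \<in> bergman D" for f using T that by (simp add: bdd_op_def)
  obtain C where C: "\<And>f. f \<in> bergman D \<Longrightarrow> berg_norm D (T f) \<le> C * berg_norm D f"
    using T unfolding bdd_op_def by blast
  show ?thesis
  proof (rule bergman_Riesz[OF D, where C = "C * berg_norm D g"])
    fix f f' assume f: "f \<in> bergman D" "f' \<in> bergman D"
    have "berg_ip D (T (\<lambda>z. f z + f' z)) g = berg_ip D (\<lambda>z. T f z + T f' z) g"
      using T f by (intro berg_ip_cong) (auto simp: bdd_op_def)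
    then show "berg_ip D (T (\<lambda>z. f z + f' z)) g = berg_ip D (T f) g + berg_ip D (T f') g"
      using berg_ip_add[OF D mem mem g] f by simp
  next
    fix f c assume f: "f \<in> bergman D"
    have "berg_ip D (T (\<lambda>z. c * f z)) g = berg_ip D (\<lambda>z. c * T f z) g"
      using T f by (intro berg_ip_cong) (auto simp: bdd_op_def)
    then show "berg_ip D (T (\<lambda>z. c * f z)) g = c * berg_ip D (T f) g" by (simp add: berg_ip_cmult)
  next
    fix f assume f: "f \<in> bergman D"
    have "cmod (berg_ip D (T f) g) \<le> berg_norm D (T f) * berg_norm D g"
      using berg_Cauchy_Schwarz[OF D mem[OF f] g]
      by (simp add: berg_norm_eq real_sqrt_mult[symmetric] real_le_rsqrt)
    also have "\<dots> \<le> (C * berg_norm D f) * berg_norm D g"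
      by (intro mult_right_mono C f) (simp add: berg_norm_eq)
    finally show "cmod (berg_ip D (T f) g) \<le> C * berg_norm D g * berg_norm D f"
      by (simp add: ac_simps)
  qed
qed

text \<open>\<open>h\<close> plays the role of \<open>T\<^sup>* 1\<close>.\<close>

lemma Vstar_moments:
  fixes \<Phi> :: "'n::finite cvec \<Rightarrow> 'm::finite cvec"
  assumes D: "open D" "bounded D" and \<Phi>: "holo_map_on D \<Phi>" "bounded (\<Phi> ` D)" and T: "T \<in> Vstar \<Phi> D"
    and h: "h \<in> bergman D" "\<And>f. f \<in> bergman D \<Longrightarrow> berg_ip D (T f) (\<lambda>_. 1) = berg_ip D f h"
    and f: "f \<in> bergman D" and u: "cpoly2 u"
  shows "set_integrable lebesgue D (\<lambda>z. u (\<Phi> z) * (T f z - f z * cnj (h z)))"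
    and "(LINT z:D|lebesgue. u (\<Phi> z) * (T f z - f z * cnj (h z))) = 0"
proof -
  let ?\<phi> = "\<lambda>j z. \<Phi> z $ j"
  obtain B where B: "\<And>z. z \<in> D \<Longrightarrow> norm (\<Phi> z) \<le> B" using \<Phi>(2) unfolding bounded_iff by blast
  have hol: "holo_on D (?\<phi> j)" for j using \<Phi>(1) by (simp add: holo_map_on_def)
  have bd: "cmod (\<Phi> z $ j) \<le> B" if "z \<in> D" for z j
    using B[OF that] Finite_Cartesian_Product.norm_nth_le[of "\<Phi> z" j] by linarith
  have mult_mem: "mult_op (?\<phi> j) f \<in> bergman D" if "f \<in> bergman D" for f j
    unfolding mult_op_def using bergman_mult_bounded[OF D(1) that hol bd] .
  have bT: "bdd_op D T" using T by (simp add: Vstar_def)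
  have T_mem: "T f \<in> bergman D" if "f \<in> bergman D" for f using bT that by (simp add: bdd_op_def)
  have one: "(\<lambda>_. 1) \<in> bergman D" by (rule bergman_const[OF D])
  \<comment> \<open>Each induction step moves one coordinate factor past \<open>T\<close>;
    membership is carried along because \<open>commute_on\<close> speaks only of functions in the
    Bergman space.\<close>
  have pol: "(\<lambda>z. p (\<Phi> z) * f z) \<in> bergman D \<and> (\<forall>z\<in>D. T (\<lambda>z. p (\<Phi> z) * f z) z = p (\<Phi> z) * T f z)"
    if "cpoly p" "f \<in> bergman D" for p f
    using that
  proof (induction p rule: cpoly.induct)
    case (const c)
    then show ?case using bT bergman_cmult[OF D(1)] by (simp add: bdd_op_def)
  next
    case (add p q)
    then show ?case using bT bergman_add[OF D(1)] by (simp add: bdd_op_def distrib_right)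
  next
    case (coord p j)
    let ?g = "\<lambda>z. p (\<Phi> z) * f z"
    have g: "?g \<in> bergman D" "\<And>z. z \<in> D \<Longrightarrow> T ?g z = p (\<Phi> z) * T f z" using coord by auto
    have eq: "(\<lambda>z. \<Phi> z $ j * p (\<Phi> z) * f z) = mult_op (?\<phi> j) ?g" by (simp add: mult_op_def mult.assoc)
    have "commute_on D T (mult_op (?\<phi> j))" using T by (simp add: Vstar_def)
    then have "T (mult_op (?\<phi> j) ?g) z = \<Phi> z $ j * p (\<Phi> z) * T f z" if "z \<in> D" for z
      using that g by (simp add: commute_on_def mult_op_def mult.assoc)
    then show ?case unfolding eq using mult_mem[OF g(1)] by blast
  qed
  \<comment> \<open>The adjoint counterpart, kept universal in \<open>f\<close> because the
    coordinate step replaces \<open>f\<close> by \<open>S f\<close>: the factor moves to the left as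
    \<open>S\<close>, passes \<open>T\<close>, and returns. The trailing \<open>* 1\<close> makes
    these functions instances of \<open>pol\<close> at the constant 1.\<close>
  have conj: "\<forall>f\<in>bergman D. berg_ip D (T f) (\<lambda>z. q (\<Phi> z) * 1) = berg_ip D f (\<lambda>z. q (\<Phi> z) * h z)"
    if "cpoly q" for q
    using that
  proof (induction q rule: cpoly.induct)
    case (const c)
    then show ?case using h(2) berg_ip_cmult_right[of D _ c "\<lambda>_. 1"] by (simp add: berg_ip_cmult_right)
  next
    case (add p q)
    show ?case
    proof
      fix f assume f: "f \<in> bergman D"
      have "berg_ip D (T f) (\<lambda>z. p (\<Phi> z) * 1 + q (\<Phi> z) * 1)
          = berg_ip D (T f) (\<lambda>z. p (\<Phi> z) * 1) + berg_ip D (T f) (\<lambda>z. q (\<Phi> z) * 1)"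
        using pol[OF add(1) one] pol[OF add(2) one] by (intro berg_ip_add_right[OF D(1) _ _ T_mem[OF f]]) auto
      also have "\<dots> = berg_ip D f (\<lambda>z. p (\<Phi> z) * h z) + berg_ip D f (\<lambda>z. q (\<Phi> z) * h z)"
        using add f by simp
      also have "\<dots> = berg_ip D f (\<lambda>z. p (\<Phi> z) * h z + q (\<Phi> z) * h z)"
        using pol[OF add(1) h(1)] pol[OF add(2) h(1)] by (intro berg_ip_add_right[OF D(1) _ _ f, symmetric]) auto
      finally show "berg_ip D (T f) (\<lambda>z. (p (\<Phi> z) + q (\<Phi> z)) * 1) = berg_ip D f (\<lambda>z. (p (\<Phi> z) + q (\<Phi> z)) * h z)"
        by (simp add: distrib_right)
    qed
  next
    case (coord q j)
    obtain S where S: "is_adjoint D (mult_op (?\<phi> j)) S"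
      using mult_op_adjoint_exists[OF D(1) hol bd] by blast
    have S_mem: "S f \<in> bergman D" if "f \<in> bergman D" for f using S that by (simp add: is_adjoint_def)
    have adj: "berg_ip D a (mult_op (?\<phi> j) b) = berg_ip D (S a) b" if "a \<in> bergman D" "b \<in> bergman D" for a b
      using S that berg_ip_commute[of D a] berg_ip_commute[of D "S a" b] unfolding is_adjoint_def by metis
    have "commute_on D T S" using T S by (simp add: Vstar_def)
    then have TS: "T (S f) z = S (T f) z" if "f \<in> bergman D" "z \<in> D" for f z
      using that by (simp add: commute_on_def)
    let ?Q = "\<lambda>z. q (\<Phi> z) * 1" and ?Qh = "\<lambda>z. q (\<Phi> z) * h z"
    show ?case
    proof
      fix f assume f: "f \<in> bergman D"
      have "berg_ip D (T f) (mult_op (?\<phi> j) ?Q) = berg_ip D (S (T f)) ?Q"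
        using pol[OF coord(1) one] T_mem[OF f] by (intro adj) auto
      also have "\<dots> = berg_ip D (T (S f)) ?Q" using TS[OF f] by (intro berg_ip_cong) auto
      also have "\<dots> = berg_ip D (S f) ?Qh" using coord(2) S_mem[OF f] by blast
      also have "\<dots> = berg_ip D f (mult_op (?\<phi> j) ?Qh)"
        using pol[OF coord(1) h(1)] f by (intro adj[symmetric]) auto
      finally show "berg_ip D (T f) (\<lambda>z. \<Phi> z $ j * q (\<Phi> z) * 1) = berg_ip D f (\<lambda>z. \<Phi> z $ j * q (\<Phi> z) * h z)"
        by (simp add: mult_op_def mult.assoc)
    qed
  qed
  have "set_integrable lebesgue D (\<lambda>z. u (\<Phi> z) * (T f z - f z * cnj (h z)))
    \<and> (LINT z:D|lebesgue. u (\<Phi> z) * (T f z - f z * cnj (h z))) = 0"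
    using u
  proof (induction u rule: cpoly2.induct)
    case (base p q)
    let ?P = "\<lambda>z. p (\<Phi> z) * T f z" and ?P' = "\<lambda>z. p (\<Phi> z) * f z"
      and ?Q = "\<lambda>z. q (\<Phi> z) * 1" and ?Qh = "\<lambda>z. q (\<Phi> z) * h z"
    have P: "?P \<in> bergman D" using pol[OF base(1) T_mem[OF f]] by blast
    have P': "?P' \<in> bergman D" using pol[OF base(1) f] by blast
    have Q: "?Q \<in> bergman D" using pol[OF base(2) one] by blast
    have Qh: "?Qh \<in> bergman D" using pol[OF base(2) h(1)] by blast
    have eq: "p (\<Phi> z) * cnj (q (\<Phi> z)) * (T f z - f z * cnj (h z)) = ?P z * cnj (?Q z) - ?P' z * cnj (?Qh z)" for z
      by (simp add: algebra_simps)
    note ints = bergman_ip_integrable[OF D(1) P Q] bergman_ip_integrable[OF D(1) P' Qh]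
    \<comment> \<open>\<open>p\<close> is absorbed into the argument of \<open>T\<close>; then
      \<open>conj\<close> trades \<open>T\<close> for the factor \<open>h\<close> on the other
      side.\<close>
    have "berg_ip D ?P ?Q = berg_ip D (T ?P') ?Q"
      using pol[OF base(1) f] by (intro berg_ip_cong) auto
    also have "\<dots> = berg_ip D ?P' ?Qh" using conj[OF base(2)] P' by blast
    finally have "berg_ip D ?P ?Q - berg_ip D ?P' ?Qh = 0" by simp
    then show ?case
      unfolding eq using set_integral_diff[OF ints] by (simp add: berg_ip_def)
  next
    case (add u v)
    then show ?case by (simp add: distrib_right set_integral_add)
  qed
  then show "set_integrable lebesgue D (\<lambda>z. u (\<Phi> z) * (T f z - f z * cnj (h z)))"
    and "(LINT z:D|lebesgue. u (\<Phi> z) * (T f z - f z * cnj (h z))) = 0" by auto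
qed

text \<open>On the compact closure of the image, replacing \<open>v\<close> by a polynomial within
  \<open>e\<close> changes the integral by at most \<open>e\<close> times the integral of
  \<open>cmod (F z)\<close>, and the polynomial's integral vanishes.\<close>

lemma moments_zero_imp_continuous:
  fixes \<Phi> :: "'a::euclidean_space \<Rightarrow> 'n::finite cvec" and F :: "'a \<Rightarrow> complex"
  assumes D: "open D" and \<Phi>: "continuous_on D \<Phi>" "bounded (\<Phi> ` D)" and F: "set_integrable lebesgue D F"
    and mom: "\<And>u. cpoly2 u \<Longrightarrow> (LINT z:D|lebesgue. u (\<Phi> z) * F z) = 0"
    and v: "continuous_on UNIV v"
  shows "(LINT z:D|lebesgue. of_real (v (\<Phi> z)) * F z) = 0"
proof -
  let ?K = "closure (\<Phi> ` D)"
  have K: "compact ?K" using \<Phi>(2) by simp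
  have int: "set_integrable lebesgue D (\<lambda>z. of_real (w (\<Phi> z)) * F z)" if w: "continuous_on UNIV w" for w :: "'n cvec \<Rightarrow> real"
  proof -
    have "compact (w ` ?K)" using K w by (intro compact_continuous_image) (auto intro: continuous_on_subset)
    then have "bounded (w ` ?K)" by (rule compact_imp_bounded)
    then obtain B where B: "\<And>y. y \<in> ?K \<Longrightarrow> \<bar>w y\<bar> \<le> B" by (auto simp: bounded_iff)
    have m: "set_borel_measurable lebesgue D (\<lambda>z. complex_of_real (w (\<Phi> z)))"
      using D by (intro set_borel_measurable_continuous continuous_intros continuous_on_compose2[OF w \<Phi>(1)]) auto
    show ?thesis
    proof (rule set_integrable_bound)
      show "set_integrable lebesgue D (\<lambda>z. of_real B * F z)" using F by simp
      have "(\<lambda>z. (indicator D z *\<^sub>R complex_of_real (w (\<Phi> z))) * (indicator D z *\<^sub>R F z)) \<in> borel_measurable lebesgue"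
        using m F unfolding set_borel_measurable_def set_integrable_def by measurable
      moreover have "(\<lambda>z. (indicator D z *\<^sub>R complex_of_real (w (\<Phi> z))) * (indicator D z *\<^sub>R F z))
          = (\<lambda>z. indicator D z *\<^sub>R (complex_of_real (w (\<Phi> z)) * F z))"
        by (auto simp: indicator_def)
      ultimately show "set_borel_measurable lebesgue D (\<lambda>z. complex_of_real (w (\<Phi> z)) * F z)"
        unfolding set_borel_measurable_def by simp
      show "AE z in lebesgue. z \<in> D \<longrightarrow> cmod (of_real (w (\<Phi> z)) * F z) \<le> cmod (of_real B * F z)"
      proof (intro AE_I2 impI)
        fix z assume "z \<in> D"
        then have "\<bar>w (\<Phi> z)\<bar> \<le> \<bar>B\<bar>" using B[of "\<Phi> z"] closure_subset[of "\<Phi> ` D"] by force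
        then show "cmod (of_real (w (\<Phi> z)) * F z) \<le> cmod (of_real B * F z)"
          by (simp add: norm_mult mult_right_mono)
      qed
    qed
  qed
  let ?I = "LINT z:D|lebesgue. of_real (v (\<Phi> z)) * F z" and ?N = "LINT z:D|lebesgue. cmod (F z)"
  have N: "set_integrable lebesgue D (\<lambda>z. cmod (F z))" using F by (rule set_integrable_norm)
  have "cmod ?I \<le> e * ?N" if e: "e > 0" for e
  proof -
    obtain g where g: "real_polynomial_function g" "\<And>y. y \<in> ?K \<Longrightarrow> \<bar>v y - g y\<bar> < e"
      using Stone_Weierstrass_real_polynomial_function[OF K continuous_on_subset[OF v] e] by blast
    have gc: "continuous_on UNIV g"
      using g(1) by (simp add: continuous_real_polymonial_function continuous_at_imp_continuous_on)
    have dc: "continuous_on UNIV (\<lambda>y. v y - g y)" using v gc by (intro continuous_intros)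
    have "(LINT z:D|lebesgue. of_real (g (\<Phi> z)) * F z) = 0"
      by (rule mom[OF real_polynomial_function_cpoly2[OF g(1)]])
    then have "?I = (LINT z:D|lebesgue. of_real (v (\<Phi> z)) * F z) - (LINT z:D|lebesgue. of_real (g (\<Phi> z)) * F z)" by simp
    also have "\<dots> = (LINT z:D|lebesgue. of_real (v (\<Phi> z)) * F z - of_real (g (\<Phi> z)) * F z)"
      by (rule set_integral_diff(2)[symmetric]) (intro int v gc)+
    also have "\<dots> = (LINT z:D|lebesgue. of_real (v (\<Phi> z) - g (\<Phi> z)) * F z)"
      by (simp add: left_diff_distrib)
    finally have "cmod ?I \<le> (LINT z:D|lebesgue. cmod (of_real (v (\<Phi> z) - g (\<Phi> z)) * F z))"
      using set_integral_norm_bound[OF int[OF dc]] by simp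
    also have "\<dots> \<le> (LINT z:D|lebesgue. e * cmod (F z))"
    proof (rule set_integral_mono)
      show "set_integrable lebesgue D (\<lambda>z. cmod (of_real (v (\<Phi> z) - g (\<Phi> z)) * F z))"
        using int[OF dc] by (rule set_integrable_norm)
      show "set_integrable lebesgue D (\<lambda>z. e * cmod (F z))" using N by simp
      fix z assume "z \<in> D"
      then have "\<bar>v (\<Phi> z) - g (\<Phi> z)\<bar> \<le> e" using g(2)[of "\<Phi> z"] closure_subset[of "\<Phi> ` D"] by force
      then show "cmod (of_real (v (\<Phi> z) - g (\<Phi> z)) * F z) \<le> e * cmod (F z)"
        unfolding norm_mult norm_of_real by (intro mult_right_mono) auto
    qed
    also have "\<dots> = e * ?N" by simp
    finally show ?thesis .
  qed
  moreover have "((\<lambda>e. e * ?N) \<longlongrightarrow> 0 * ?N) (at_right 0)" by (intro tendsto_intros)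
  ultimately have "cmod ?I \<le> 0 * ?N"
    by (intro tendsto_lowerbound[of "\<lambda>e. e * ?N" "0 * ?N" "at_right 0"]) (auto simp: eventually_at_right_less eventually_at_filter)
  then show ?thesis by simp
qed

text \<open>The indicator of a closed set is the pointwise limit of the continuous cutoffs
  \<open>v n\<close>; dominated convergence with majorant \<open>cmod (F z)\<close> transfers the
  vanishing.\<close>

lemma moments_zero_imp_compact:
  fixes \<Phi> :: "'a::euclidean_space \<Rightarrow> 'n::finite cvec" and F :: "'a \<Rightarrow> complex"
  assumes D: "open D" and \<Phi>: "continuous_on D \<Phi>" "bounded (\<Phi> ` D)" and F: "set_integrable lebesgue D F"
    and mom: "\<And>u. cpoly2 u \<Longrightarrow> (LINT z:D|lebesgue. u (\<Phi> z) * F z) = 0"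
    and E: "closed E" "E \<noteq> {}"
  shows "(LINT z:D|lebesgue. indicator E (\<Phi> z) * F z) = 0"
proof -
  define v where "v n y = max 0 (1 - real n * infdist y E)" for n y
  have v: "continuous_on UNIV (v n)" for n unfolding v_def by (intro continuous_intros)
  have v01: "0 \<le> v n y" "v n y \<le> 1" for n y by (auto simp: v_def infdist_nonneg)
  have lim: "(\<lambda>n. v n y) \<longlonglongrightarrow> indicator E y" for y
  proof (cases "y \<in> E")
    case True
    then show ?thesis by (simp add: v_def)
  next
    case False
    then have pos: "infdist y E > 0"
      using in_closed_iff_infdist_zero[OF E, of y] infdist_nonneg[of y E] by linarith
    obtain N where N: "1 / infdist y E < real N" using reals_Archimedean2 by blast
    have "v n y = 0" if "n \<ge> N" for n
    proof -
      have "1 / infdist y E < real n" using N that by linarith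
      then show ?thesis using pos by (simp add: v_def field_simps)
    qed
    then have "\<forall>\<^sub>F n in sequentially. v n y = indicator E y"
      using False unfolding eventually_sequentially by auto
    then show ?thesis by (rule tendsto_eventually)
  qed
  let ?s = "\<lambda>n z. indicator D z *\<^sub>R (complex_of_real (v n (\<Phi> z)) * F z)"
  have meas_F: "(\<lambda>z. indicator D z *\<^sub>R F z) \<in> borel_measurable lebesgue"
    using F unfolding set_integrable_def by measurable
  have meas: "?s n \<in> borel_measurable lebesgue" for n
  proof -
    have "set_borel_measurable lebesgue D (\<lambda>z. complex_of_real (v n (\<Phi> z)))"
      using D by (intro set_borel_measurable_continuous continuous_intros continuous_on_compose2[OF v \<Phi>(1)]) auto
    then have "(\<lambda>z. (indicator D z *\<^sub>R complex_of_real (v n (\<Phi> z))) * (indicator D z *\<^sub>R F z)) \<in> borel_measurable lebesgue"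
      using meas_F unfolding set_borel_measurable_def by measurable
    moreover have "(\<lambda>z. (indicator D z *\<^sub>R complex_of_real (v n (\<Phi> z))) * (indicator D z *\<^sub>R F z)) = ?s n"
      by (auto simp: indicator_def)
    ultimately show ?thesis by simp
  qed
  have ptw: "(\<lambda>n. ?s n z) \<longlonglongrightarrow> indicator D z *\<^sub>R (indicator E (\<Phi> z) * F z)" for z
  proof -
    have "(\<lambda>n. complex_of_real (v n (\<Phi> z))) \<longlonglongrightarrow> complex_of_real (indicator E (\<Phi> z))"
      by (intro tendsto_of_real lim)
    moreover have "complex_of_real (indicator E (\<Phi> z)) = indicator E (\<Phi> z)" by (simp add: indicator_def)
    ultimately have "(\<lambda>n. complex_of_real (v n (\<Phi> z))) \<longlonglongrightarrow> indicator E (\<Phi> z)" by simp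
    then show ?thesis by (intro tendsto_intros)
  qed
  have "(\<lambda>n. LINT z|lebesgue. ?s n z) \<longlonglongrightarrow> (LINT z|lebesgue. indicator D z *\<^sub>R (indicator E (\<Phi> z) * F z))"
  proof (rule integral_dominated_convergence[where w = "\<lambda>z. norm (indicator D z *\<^sub>R F z)"])
    show "(\<lambda>z. indicator D z *\<^sub>R (indicator E (\<Phi> z) * F z)) \<in> borel_measurable lebesgue"
      by (rule borel_measurable_LIMSEQ_metric[OF meas]) (rule ptw)
    show "integrable lebesgue (\<lambda>z. norm (indicator D z *\<^sub>R F z))"
      using F unfolding set_integrable_def by (rule integrable_norm)
    show "AE z in lebesgue. norm (?s n z) \<le> norm (indicator D z *\<^sub>R F z)" for n
    proof (rule AE_I2)
      fix z
      have "\<bar>v n (\<Phi> z)\<bar> * cmod (F z) \<le> 1 * cmod (F z)" using v01[of n "\<Phi> z"] by (intro mult_right_mono) auto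
      then show "norm (?s n z) \<le> norm (indicator D z *\<^sub>R F z)"
        by (simp add: indicator_def norm_mult)
    qed
  qed (use meas ptw in auto)
  moreover have "(LINT z|lebesgue. ?s n z) = 0" for n
    using moments_zero_imp_continuous[OF D \<Phi> F mom v, of n] by (simp add: set_lebesgue_integral_def)
  ultimately have "(\<lambda>n::nat. 0) \<longlonglongrightarrow> (LINT z|lebesgue. indicator D z *\<^sub>R (indicator E (\<Phi> z) * F z))" by simp
  then show ?thesis
    unfolding set_lebesgue_integral_def using LIMSEQ_unique tendsto_const by blast
qed

lemma cball_integrals_zero_imp_zero:
  fixes F :: "'a::euclidean_space \<Rightarrow> complex"
  assumes W: "open W" "w \<in> W" and F: "continuous_on W F"
    and zero: "\<And>r. r > 0 \<Longrightarrow> cball w r \<subseteq> W \<Longrightarrow> (LINT z:cball w r|lebesgue. F z) = 0"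
  shows "F w = 0"
proof (rule ccontr)
  assume nz: "F w \<noteq> 0"
  have "isCont F w" using F W by (simp add: continuous_on_eq_continuous_at)
  then obtain d where d: "d > 0" "\<And>z. dist z w < d \<Longrightarrow> dist (F z) (F w) < cmod (F w) / 2"
    using nz unfolding continuous_at_eps_delta by (metis half_gt_zero zero_less_norm_iff)
  obtain R where R: "R > 0" "cball w R \<subseteq> W" using W open_contains_cball by blast
  define r where "r = min R (d/2)"
  have r: "r > 0" "cball w r \<subseteq> W" "\<And>z. z \<in> cball w r \<Longrightarrow> cmod (F z - F w) \<le> cmod (F w) / 2"
  proof -
    show "r > 0" "cball w r \<subseteq> W" using R d(1) by (auto simp: r_def)
    fix z assume "z \<in> cball w r"
    then have "dist z w < d" using d(1) by (auto simp: r_def dist_commute)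
    from d(2)[OF this] show "cmod (F z - F w) \<le> cmod (F w) / 2" by (simp add: dist_norm)
  qed
  let ?B = "cball w r" and ?V = "measure lebesgue (cball w r)"
  have V: "?V > 0" using content_cball_pos[of r w] r(1) by simp
  have cont_int: "set_integrable lebesgue ?B f" if "continuous_on ?B f" for f :: "'a \<Rightarrow> 'b::{banach, second_countable_topology}"
    using borel_integrable_compact[OF compact_cball that] unfolding set_integrable_def
    by (simp add: integrable_completion borel_measurable_integrable)
  have Fi: "set_integrable lebesgue ?B F" by (rule cont_int[OF continuous_on_subset[OF F r(2)]])
  have const: "(LINT z:?B|lebesgue. c) = ?V *\<^sub>R c" for c :: "'b::{banach, second_countable_topology}"
    using cont_int[of "\<lambda>_. 1::real"] by (simp add: set_lebesgue_integral_def set_integrable_def)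
  have "(LINT z:?B|lebesgue. F z - F w) = - (?V *\<^sub>R F w)"
    using zero[OF r(1,2)] set_integral_diff(2)[OF Fi cont_int[of "\<lambda>_. F w"]] by (simp add: const)
  then have "?V * cmod (F w) = cmod (LINT z:?B|lebesgue. F z - F w)" using V by simp
  also have "\<dots> \<le> (LINT z:?B|lebesgue. cmod (F z - F w))"
    by (intro set_integral_norm_bound set_integral_diff(1) Fi cont_int) auto
  also have "\<dots> \<le> (LINT z:?B|lebesgue. cmod (F w) / 2)"
  proof (rule set_integral_mono)
    show "set_integrable lebesgue ?B (\<lambda>z. cmod (F z - F w))"
      by (intro set_integrable_norm set_integral_diff(1) Fi cont_int) auto
  qed (use r(3) in \<open>auto intro!: cont_int\<close>)
  also have "\<dots> = ?V * (cmod (F w) / 2)" by (simp add: const)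
  finally have "cmod (F w) \<le> cmod (F w) / 2" using V by (rule mult_left_le_imp_le)
  then show False using nz by simp
qed

text \<open>The derivative of \<open>k\<close> is complex linear and, as the conjugate of that of
  \<open>h\<close>, also conjugate linear; comparing the two at \<open>\<i> *s v\<close> gives
  zero.\<close>

lemma holo_conj_holo_derivative_zero:
  assumes W: "open W" "z \<in> W" and h: "holo_on W h" and k: "holo_on W k" and eq: "\<And>z. z \<in> W \<Longrightarrow> k z = cnj (h z)"
  shows "dird k z = (\<lambda>_. 0)"
proof
  fix v
  let ?L = "dird h z"
  have "((\<lambda>z. cnj (h z)) has_derivative (\<lambda>v. cnj (?L v))) (at z)"
    by (rule has_derivative_cnj[OF holo_on_has_derivative(1)[OF h W(2)]])
  then have "(k has_derivative (\<lambda>v. cnj (?L v))) (at z)"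
    by (rule has_derivative_transform_within_open[OF _ W]) (simp add: eq)
  then have k': "dird k z = (\<lambda>v. cnj (?L v))"
    using has_derivative_unique holo_on_has_derivative(1)[OF k W(2)] by blast
  have "dird k z (\<i> *s v) = \<i> * dird k z v" by (rule holo_on_has_derivative(2)[OF k W(2)])
  moreover have "dird k z (\<i> *s v) = - \<i> * dird k z v"
    by (simp add: k' holo_on_has_derivative(2)[OF h W(2)])
  ultimately show "dird k z v = 0" by simp
qed

lemma Vstar_trivial_of_separated:
  fixes \<Phi> :: "'n::finite cvec \<Rightarrow> 'n cvec"
  assumes D: "is_domain D" "bounded D" and \<Phi>: "holo_map_on D \<Phi>" "bounded (\<Phi> ` D)"
    and W: "open W" "W \<noteq> {}" "W \<subseteq> D" "inj_on \<Phi> W"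
    and sep: "\<And>z w. z \<in> D \<Longrightarrow> w \<in> W \<Longrightarrow> \<Phi> z = \<Phi> w \<Longrightarrow> z \<in> W"
  shows "Vstar_trivial \<Phi> D"
  unfolding Vstar_trivial_def
proof
  fix T assume T: "T \<in> Vstar \<Phi> D"
  have op: "open D" and conn: "connected D" using D by (auto simp: is_domain_def)
  have bT: "bdd_op D T" using T by (simp add: Vstar_def)
  have one: "(\<lambda>_. 1) \<in> bergman D" by (rule bergman_const[OF op D(2)])
  have T_mem: "T f \<in> bergman D" if "f \<in> bergman D" for f using bT that by (simp add: bdd_op_def)
  obtain h where h: "h \<in> bergman D" "\<And>f. f \<in> bergman D \<Longrightarrow> berg_ip D (T f) (\<lambda>_. 1) = berg_ip D f h"
    using bdd_op_riesz[OF op bT one] by blast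
  have \<Phi>c: "continuous_on D \<Phi>" by (rule holo_map_continuous_on[OF \<Phi>(1)])
  have loc: "T f w = f w * cnj (h w)" if f: "f \<in> bergman D" and w: "w \<in> W" for f w
  proof -
    define F where "F z = T f z - f z * cnj (h z)" for z
    have mom: "set_integrable lebesgue D (\<lambda>z. u (\<Phi> z) * F z)" "(LINT z:D|lebesgue. u (\<Phi> z) * F z) = 0"
      if "cpoly2 u" for u
      using Vstar_moments[OF op D(2) \<Phi> T h(1) _ f that] h(2) unfolding F_def by blast+
    have Fi: "set_integrable lebesgue D F" using mom(1)[OF cpoly2_const[of 1]] by simp
    have "F w = 0"
    proof (rule cball_integrals_zero_imp_zero[OF W(1) w])
      show "continuous_on W F"
        unfolding F_def
        by (intro continuous_intros continuous_on_subset[OF bergman_continuous W(3)] T_mem f h(1))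
      fix r :: real assume r: "r > 0" "cball w r \<subseteq> W"
      \<comment> \<open>Inside \<open>D\<close> the preimage of this set is the ball itself, by
        \<open>sep\<close> and injectivity on \<open>W\<close>; so the moment against its indicator
        is the integral of \<open>F\<close> over the ball.\<close>
      let ?E = "\<Phi> ` cball w r"
      have "compact ?E"
        using r W(3) by (intro compact_continuous_image continuous_on_subset[OF \<Phi>c]) auto
      then have "closed ?E" "?E \<noteq> {}" using r(1) by (auto simp: compact_imp_closed)
      from moments_zero_imp_compact[OF op \<Phi>c \<Phi>(2) Fi mom(2) this]
      have "(LINT z:D|lebesgue. indicator ?E (\<Phi> z) * F z) = 0" by simp
      moreover have "indicator D z *\<^sub>R (indicator ?E (\<Phi> z) * F z) = indicator (cball w r) z *\<^sub>R F z" for z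
      proof -
        have "\<Phi> z \<in> ?E \<longleftrightarrow> z \<in> cball w r" if "z \<in> D"
        proof
          assume "\<Phi> z \<in> ?E"
          then obtain y where y: "y \<in> cball w r" "\<Phi> z = \<Phi> y" by blast
          then have "z \<in> W" using sep[OF that] r(2) by blast
          then have "z = y" using inj_onD[OF W(4) y(2)] y(1) r(2) by blast
          then show "z \<in> cball w r" using y(1) by simp
        qed blast
        then show ?thesis using r(2) W(3) by (auto simp: indicator_def)
      qed
      ultimately show "(LINT z:cball w r|lebesgue. F z) = 0"
        unfolding set_lebesgue_integral_def by simp
    qed
    then show ?thesis by (simp add: F_def)
  qed
  obtain w0 r where w0: "r > 0" "ball w0 r \<subseteq> W" using W(1,2) open_contains_ball by blast
  let ?k = "T (\<lambda>_. 1)"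
  have hol: "holo_on W ?k" "holo_on W h"
    using bergman_holo[OF T_mem[OF one]] bergman_holo[OF h(1)] W(3) by (auto intro: holo_on_subset)
  have k_eq: "?k z = cnj (h z)" if "z \<in> W" for z using loc[OF one that] by simp
  have "\<exists>c. \<forall>z\<in>ball w0 r. ?k z = c"
  proof (rule has_derivative_zero_constant[OF convex_ball])
    fix z assume z: "z \<in> ball w0 r"
    then have "z \<in> W" using w0 by blast
    then have "(?k has_derivative (\<lambda>_. 0)) (at z)"
      using holo_on_has_derivative(1)[OF hol(1)] holo_conj_holo_derivative_zero[OF W(1) _ hol(2,1) k_eq] by metis
    then show "(?k has_derivative (\<lambda>_. 0)) (at z within ball w0 r)" by (rule has_derivative_at_withinI)
  qed
  then obtain c where c: "\<And>z. z \<in> ball w0 r \<Longrightarrow> ?k z = c" by blast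
  \<comment> \<open>The identity holds on a ball, and the identity theorem carries it to all of the
    connected \<open>D\<close>.\<close>
  have "T f z = c * f z" if f: "f \<in> bergman D" and z: "z \<in> D" for f z
  proof -
    have "T f z - c * f z = 0"
    proof (rule line_holo_identity[OF _ op conn, of "\<lambda>z. T f z - c * f z" "ball w0 r"])
      show "line_holo D (\<lambda>z. T f z - c * f z)"
        by (intro holo_on_imp_line_holo holo_on_diff holo_on_cmult bergman_holo T_mem f)
      fix y assume y: "y \<in> ball w0 r"
      then have "y \<in> W" using w0 by blast
      then show "T f y - c * f y = 0" using loc[OF f, of y] k_eq[of y] c[OF y] by simp
    qed (use w0 W(3) z in auto)
    then show ?thesis by simp
  qed
  then show "\<exists>c. \<forall>f\<in>bergman D. \<forall>z\<in>D. T f z = c * f z" by blast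
qed

section \<open>Enlarging the domain\<close>

lemma separated_enlargement:
  fixes \<Phi> :: "'n::finite cvec \<Rightarrow> 'n cvec"
  assumes \<Omega>: "is_domain \<Omega>" "bounded \<Omega>" "prop1 \<Omega>"
    and U: "open U" "closure \<Omega> \<subseteq> U" and \<Phi>: "holo_map_on U \<Phi>"
    and int: "interior (\<Phi> ` \<Omega>) \<noteq> {}" and \<epsilon>: "\<epsilon> > 0"
  obtains D W where "is_domain D" "bounded D" "prop1 D" "prop2 D" "\<Omega> \<subseteq> D" "D - \<Omega> \<subseteq> nbhd (frontier \<Omega>) \<epsilon>"
    "closure D \<subseteq> U" "open W" "W \<noteq> {}" "W \<subseteq> D" "inj_on \<Phi> W"
    "\<And>z w. z \<in> D \<Longrightarrow> w \<in> W \<Longrightarrow> \<Phi> z = \<Phi> w \<Longrightarrow> z \<in> W"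
proof -
  have op: "open \<Omega>" and conn: "connected \<Omega>" and ne: "\<Omega> \<noteq> {}" using \<Omega> by (auto simp: is_domain_def)
  have \<Omega>U: "\<Omega> \<subseteq> U" using U(2) closure_subset by blast
  \<comment> \<open>Any coordinate will do; index types are nonempty.\<close>
  fix j :: 'n
  define \<psi> where "\<psi> z = Re (\<Phi> z $ j)" for z
  have \<psi>_cont: "continuous_on U \<psi>"
    unfolding \<psi>_def by (intro continuous_intros holo_map_continuous_on[OF \<Phi>])
  have "compact (closure \<Omega>)" using \<Omega>(2) by simp
  then obtain \<zeta> where \<zeta>: "\<zeta> \<in> closure \<Omega>" and max: "\<And>z. z \<in> closure \<Omega> \<Longrightarrow> \<psi> z \<le> \<psi> \<zeta>"
    using continuous_attains_sup[of "closure \<Omega>" \<psi>] continuous_on_subset[OF \<psi>_cont U(2)] ne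
    by (metis closure_eq_empty)
  have not_max: "\<exists>z\<in>ball \<zeta> \<delta>. \<psi> \<zeta> < \<psi> z" if "\<delta> > 0" "ball \<zeta> \<delta> \<subseteq> U" for \<delta>
    unfolding \<psi>_def by (rule holo_coordinate_not_locally_maximal[OF op conn \<zeta> \<Omega>U \<Phi> int that])
  have "\<zeta> \<notin> \<Omega>"
  proof
    assume "\<zeta> \<in> \<Omega>"
    then obtain \<delta> where "\<delta> > 0" "ball \<zeta> \<delta> \<subseteq> \<Omega>" using op open_contains_ball by blast
    then obtain z where "z \<in> \<Omega>" "\<psi> \<zeta> < \<psi> z" using not_max[of \<delta>] \<Omega>U by blast
    then show False using max[of z] closure_subset by force
  qed
  then have \<zeta>F: "\<zeta> \<in> frontier \<Omega>" using \<zeta> op by (simp add: frontier_def interior_open)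
  obtain \<delta> where \<delta>: "\<delta> > 0" "ball \<zeta> \<delta> \<subseteq> U" "\<delta> \<le> \<epsilon>"
  proof -
    obtain \<delta>0 where "\<delta>0 > 0" "ball \<zeta> \<delta>0 \<subseteq> U" using U \<zeta> open_contains_ball by blast
    then show ?thesis using \<epsilon> by (intro that[of "min \<delta>0 \<epsilon>"]) auto
  qed
  \<comment> \<open>A point where \<open>\<psi>\<close> exceeds its maximum over
    \<open>closure \<Omega>\<close>, hence outside that closure: it sets the direction of the
    segment.\<close>
  obtain z1 where z1: "z1 \<in> ball \<zeta> \<delta>" "\<psi> \<zeta> < \<psi> z1" using not_max[OF \<delta>(1,2)] by blast
  let ?J = "\<lambda>z. det (jac \<Phi> z)"
  have J: "holo_on U ?J" by (rule holo_on_det_jac[OF \<Phi> U(1)])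
  have meet: "\<Omega> \<inter> ball \<zeta> \<delta> \<noteq> {}"
  proof -
    have "\<zeta> \<in> ball \<zeta> \<delta> \<inter> closure \<Omega>" using \<zeta> \<delta>(1) by simp
    then show ?thesis using open_Int_closure_eq_empty[of "ball \<zeta> \<delta>" \<Omega>] by blast
  qed
  \<comment> \<open>Otherwise the Jacobian determinant vanishes on an open part of
    \<open>\<Omega>\<close>, hence on \<open>\<Omega>\<close>, and Sard's theorem leaves the image
    without interior.\<close>
  have "\<exists>z0\<in>\<Omega> \<inter> ball \<zeta> \<delta>. ?J z0 \<noteq> 0"
  proof (rule ccontr)
    assume "\<not> ?thesis"
    then have "?J z = 0" if "z \<in> \<Omega>" for z
      using line_holo_identity[OF holo_on_imp_line_holo[OF holo_on_subset[OF J \<Omega>U]] op conn, of "\<Omega> \<inter> ball \<zeta> \<delta>" z]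
        that meet op by blast
    then show False using holo_map_degenerate_image[OF \<Phi> \<Omega>U] int by blast
  qed
  then obtain z0 where z0: "z0 \<in> \<Omega>" "z0 \<in> ball \<zeta> \<delta>" "?J z0 \<noteq> 0" by blast
  \<comment> \<open>A complex parameter makes the Jacobian determinant along the segment a
    one-variable holomorphic function, nonzero at \<open>t = 0\<close>; it has finitely many zeros
    on the segment.\<close>
  define \<gamma> where "\<gamma> t = z0 + t *s (z1 - z0)" for t
  let ?S = "{t. \<gamma> t \<in> ball \<zeta> \<delta>}"
  have S: "open ?S" "convex ?S"
    unfolding \<gamma>_def using open_cvec_line[of "ball \<zeta> \<delta>" z0 "z1 - z0"] convex_cvec_line[of "ball \<zeta> \<delta>" z0 "z1 - z0"]
    by auto
  have \<gamma>01: "\<gamma> 0 = z0" "\<gamma> 1 = z1" by (simp_all add: \<gamma>_def)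
  have seg: "closed_segment 0 1 \<subseteq> ?S"
    using S(2) z0(2) z1(1) \<gamma>01 by (intro closed_segment_subset) auto
  have real_in: "of_real t \<in> (closed_segment 0 1 :: complex set)" if "t \<in> {0..1}" for t
    using that by (auto simp: in_segment scaleR_conv_of_real)
  have \<gamma>_in: "\<gamma> (of_real t) \<in> ball \<zeta> \<delta>" if "t \<in> {0..1}" for t
    using seg real_in[OF that] by blast
  have fin: "finite {t \<in> closed_segment 0 1. ?J (\<gamma> t) = 0}"
  proof (cases "(\<lambda>t. ?J (\<gamma> t)) constant_on ?S")
    case True
    then have "?J (\<gamma> t) = ?J (\<gamma> 0)" if "t \<in> closed_segment 0 1" for t
      using seg that unfolding constant_on_def by (metis ends_in_segment(1) subsetD)
    then have "{t \<in> closed_segment 0 1. ?J (\<gamma> t) = 0} = {}" using z0(3) \<gamma>01 by auto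
    then show ?thesis by (simp only: finite.emptyI)
  next
    case False
    have "(\<lambda>t. ?J (\<gamma> t)) holomorphic_on ?S"
      using holo_on_imp_line_holo[OF holo_on_subset[OF J \<delta>(2)]] unfolding line_holo_def \<gamma>_def by blast
    then show ?thesis
      using S convex_connected seg False by (intro holomorphic_compact_finite_zeros[of _ ?S]) auto
  qed
  define p where "p t = \<psi> (\<gamma> (of_real t))" for t :: real
  have p_cont: "continuous_on {0..1} p"
    unfolding p_def
  proof (rule continuous_on_compose2[OF \<psi>_cont])
    show "continuous_on {0..1} (\<lambda>t. \<gamma> (of_real t))"
      unfolding \<gamma>_def by (rule continuous_on_compose2[OF continuous_on_cvec_line[of UNIV]]) (auto intro: continuous_intros)
  qed (use \<gamma>_in \<delta> in blast)
  have p01: "p 0 \<le> \<psi> \<zeta>" "\<psi> \<zeta> < p 1"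
    using max[of z0] z0(1) closure_subset z1(2) by (auto simp: p_def \<gamma>01)
  let ?Z = "{t \<in> {0..1}. ?J (\<gamma> (of_real t)) = 0}"
  have "of_real ` ?Z \<subseteq> {t \<in> closed_segment 0 1. ?J (\<gamma> t) = 0}" using real_in by auto
  then have "finite (complex_of_real ` ?Z)" using fin finite_subset by blast
  then have finZ: "finite ?Z" by (rule finite_imageD) (simp add: inj_on_def)
  \<comment> \<open>An interval of levels minus the finitely many values of \<open>p\<close> at
    zeros of the Jacobian: a remaining level is reached only where the Jacobian is nonzero.\<close>
  have "infinite ({\<psi> \<zeta><..<p 1} - p ` ?Z)"
    using p01(2) finZ by (intro Diff_infinite_finite finite_imageI) auto
  then have "{\<psi> \<zeta><..<p 1} - p ` ?Z \<noteq> {}" by (metis finite.emptyI)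
  then obtain s where "s \<in> {\<psi> \<zeta><..<p 1} - p ` ?Z" by blast
  then have s: "\<psi> \<zeta> < s" "s < p 1" "s \<notin> p ` ?Z" unfolding Diff_iff greaterThanLessThan_iff by blast+
  obtain t where t: "0 < t" "t \<le> 1" "p t = s" "\<And>u. 0 \<le> u \<Longrightarrow> u < t \<Longrightarrow> p u < s"
    using first_hit[OF p_cont, of s] p01 s by auto
  define q where "q = \<gamma> (of_real t)"
  have Jq: "?J q \<noteq> 0" using s(3) t unfolding q_def by force
  have q_in: "q \<in> ball \<zeta> \<delta>" unfolding q_def using \<gamma>_in t by auto
  have \<psi>q: "\<psi> q = s" using t(3) by (simp add: q_def p_def)
  obtain r where r: "r > 0" "ball q r \<subseteq> U" "inj_on \<Phi> (ball q r)"
    using holo_map_locally_injective[OF \<Phi> U(1) _ Jq] q_in \<delta>(2) by blast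
  let ?L = "closed_segment z0 q"
  have L_in: "?L \<subseteq> ball \<zeta> \<delta>" using z0(2) q_in by (intro closed_segment_subset) auto
  have L_less: "\<psi> x < s" if x: "x \<in> ?L" "x \<noteq> q" for x
  proof -
    obtain u where u: "0 \<le> u" "u \<le> 1" "x = (1 - u) *\<^sub>R z0 + u *\<^sub>R q" using x(1) by (auto simp: in_segment)
    then have "u \<noteq> 1" using x(2) by auto
    then have "u * t < t" using u t(1) by simp
    have scale: "(c *\<^sub>R v) $ i = of_real c * v $ i" for c i and v :: "'n cvec"
      by (subst vector_scaleR_component, rule scaleR_conv_of_real)
    have "x = \<gamma> (of_real (u * t))"
      by (simp add: u(3) q_def \<gamma>_def vec_eq_iff scale algebra_simps del: vector_scaleR_component)
    moreover note \<open>u * t < t\<close>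
    ultimately show ?thesis using t(1) t(4)[of "u * t"] u(1) by (simp add: p_def)
  qed
  \<comment> \<open>The first hit leaves \<open>\<psi> < s\<close> on the segment apart from
    \<open>q\<close>, and compactness gives a margin off \<open>ball q r\<close>. Taking
    \<open>s'\<close> above \<open>\<psi> \<zeta>\<close> as well keeps the superlevel set off
    \<open>closure \<Omega>\<close>.\<close>
  obtain s' where s': "\<psi> \<zeta> < s'" "s' < s" "\<And>x. x \<in> ?L - ball q r \<Longrightarrow> \<psi> x < s'"
  proof (cases "?L - ball q r = {}")
    case True
    show ?thesis by (rule that[of "(\<psi> \<zeta> + s) / 2"]) (use s(1) True in auto)
  next
    case False
    have "compact (?L - ball q r)" by (intro compact_diff) auto
    moreover have "continuous_on (?L - ball q r) \<psi>"
      using L_in \<delta>(2) by (intro continuous_on_subset[OF \<psi>_cont]) blast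
    ultimately obtain y where y: "y \<in> ?L - ball q r" "\<And>x. x \<in> ?L - ball q r \<Longrightarrow> \<psi> x \<le> \<psi> y"
      using continuous_attains_sup[of "?L - ball q r" \<psi>] False by blast
    have "y \<noteq> q" using y(1) r(1) by auto
    then have "\<psi> y < s" using L_less y(1) by blast
    then obtain s' where "max (\<psi> \<zeta>) (\<psi> y) < s'" "s' < s" using s(1) dense[of "max (\<psi> \<zeta>) (\<psi> y)" s] by auto
    then show ?thesis using y(2) by (intro that[of s']) (auto intro: le_less_trans)
  qed
  \<comment> \<open>In \<open>G\<close>, the inequality \<open>s' \<le> \<psi> z\<close> forces
    \<open>z\<close> into \<open>ball q r\<close>. Once the closed tube lies in \<open>G\<close>,
    the superlevel set in the new domain stays where \<open>\<Phi>\<close> is injective.\<close>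
  define G where "G = (ball \<zeta> \<delta> \<inter> \<psi> -` {..<s'}) \<union> (ball \<zeta> \<delta> \<inter> ball q r)"
  have "open G"
    unfolding G_def using continuous_on_subset[OF \<psi>_cont \<delta>(2)]
    by (intro open_Un open_Int continuous_open_preimage) auto
  moreover have "?L \<subseteq> G" using L_in s'(3) by (auto simp: G_def)
  ultimately obtain \<eta> where \<eta>: "\<eta> > 0" "(\<Union>x\<in>?L. ball x \<eta>) \<subseteq> G"
    using compact_subset_open_imp_ball_epsilon_subset[of ?L G] by auto
  \<comment> \<open>A Minkowski sum of convex sets, so the tube is connected with null frontier.
    Radius \<open>\<eta>/2\<close> instead of \<open>\<eta>\<close> puts even its closure into
    \<open>G\<close>; the interior of the closure taken below may pick up points of that
    closure.\<close>
  define C where "C = (\<Union>x\<in>?L. \<Union>y\<in>ball 0 (\<eta>/2). {x + y})"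
  have C_open: "open C" unfolding C_def by (rule open_sums) auto
  have C_convex: "convex C" unfolding C_def by (rule convex_sums) auto
  have L_C: "?L \<subseteq> C"
  proof
    fix x assume "x \<in> ?L"
    moreover have "0 \<in> ball (0::'n cvec) (\<eta>/2)" using \<eta>(1) by simp
    ultimately show "x \<in> C" unfolding C_def by force
  qed
  have C_G: "closure C \<subseteq> G"
  proof
    fix y assume "y \<in> closure C"
    then obtain c where c: "c \<in> C" "dist c y < \<eta>/2" using \<eta>(1) closure_approachable[of y C] by (meson half_gt_zero)
    then obtain x b where "x \<in> ?L" "norm b < \<eta>/2" "c = x + b" unfolding C_def by auto
    then have "x \<in> ?L" "dist x y < \<eta>"
      using c(2) dist_triangle[of x y c] by (auto simp: dist_norm)
    then show "y \<in> G" using \<eta>(2) by (meson UN_I mem_ball subsetD)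
  qed
  have G_sub: "G \<subseteq> ball \<zeta> \<delta>" by (auto simp: G_def)
  let ?A = "\<Omega> \<union> C"
  define D where "D = interior (closure ?A)"
  have A_D: "?A \<subseteq> D" unfolding D_def using op C_open by (intro interior_maximal closure_subset open_Un)
  have D_cl: "D \<subseteq> closure \<Omega> \<union> closure C" unfolding D_def using interior_subset by (metis closure_Un)
  have q_D: "q \<in> D" using L_C A_D by auto
  define W where "W = {z \<in> D. s' < \<psi> z}"
  have cl_D: "closure D \<subseteq> closure \<Omega> \<union> closure C"
    by (rule closure_minimal[OF D_cl]) auto
  have D_U: "closure D \<subseteq> U" using cl_D U(2) C_G G_sub \<delta>(2) by blast
  have W_ball: "W \<subseteq> ball q r"
  proof
    fix z assume z: "z \<in> W"
    then have "z \<notin> closure \<Omega>" using max[of z] s'(1) by (auto simp: W_def)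
    then have "z \<in> G" using z D_cl C_G by (auto simp: W_def)
    then show "z \<in> ball q r" using z by (auto simp: G_def W_def)
  qed
  show ?thesis
  proof (rule that)
    have "connected ?A"
      using conn convex_connected[OF C_convex] z0(1) L_C by (intro connected_Un) auto
    then have "connected D"
      using A_D interior_subset unfolding D_def by (rule connected_intermediate_closure)
    then show "is_domain D" using q_D by (auto simp: is_domain_def D_def)
    have "bounded (closure \<Omega> \<union> closure C)"
      using \<Omega>(2) bounded_subset[OF bounded_ball order_trans[OF C_G G_sub]] by (simp add: bounded_closure)
    then show "bounded D" using D_cl by (rule bounded_subset)
    have "frontier D \<subseteq> frontier \<Omega> \<union> frontier C"
      using frontier_interior_closure_subset[of ?A] frontier_Un_subset[of \<Omega> C] op C_open
      unfolding D_def by blast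
    moreover have "negligible (frontier \<Omega> \<union> frontier C)"
      using \<Omega>(3) negligible_convex_frontier[OF C_convex]
      by (intro negligible_Un) (simp_all add: prop1_def negligible_iff_null_sets)
    ultimately show "prop1 D" unfolding prop1_def negligible_iff_null_sets[symmetric]
      by (rule negligible_subset[rotated])
    show "prop2 D" unfolding D_def by (rule prop2_interior_closure)
    show "\<Omega> \<subseteq> D" using A_D by blast
    show "D - \<Omega> \<subseteq> nbhd (frontier \<Omega>) \<epsilon>"
    proof
      fix z assume z: "z \<in> D - \<Omega>"
      show "z \<in> nbhd (frontier \<Omega>) \<epsilon>"
      \<comment> \<open>New points in \<open>closure \<Omega>\<close> are frontier points
        themselves; all others lie in the closed tube, within
        \<open>\<delta> \<le> \<epsilon>\<close> of \<open>\<zeta>\<close>.\<close>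
      proof (cases "z \<in> closure \<Omega>")
        case True
        then have "z \<in> frontier \<Omega>" using z op by (simp add: frontier_def interior_open)
        then show ?thesis using \<epsilon> by (auto simp: nbhd_def intro!: bexI[of _ z])
      next
        case False
        then have "dist z \<zeta> < \<epsilon>" using z D_cl C_G G_sub \<delta>(3) by (force simp: dist_commute)
        then show ?thesis using \<zeta>F by (auto simp: nbhd_def)
      qed
    qed
    show "closure D \<subseteq> U" by (rule D_U)
    have "D \<inter> \<psi> -` {s'<..} = W" by (auto simp: W_def)
    moreover have "open (D \<inter> \<psi> -` {s'<..})"
      using D_U closure_subset[of D] by (intro continuous_open_preimage continuous_on_subset[OF \<psi>_cont]) (auto simp: D_def)
    ultimately show "open W" by simp
    show "W \<noteq> {}" using q_D \<psi>q s'(2) by (auto simp: W_def)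
    show "W \<subseteq> D" by (auto simp: W_def)
    show "inj_on \<Phi> W" using r(3) W_ball by (rule inj_on_subset)
    show "z \<in> W" if "z \<in> D" "w \<in> W" "\<Phi> z = \<Phi> w" for z w
      using that by (simp add: W_def \<psi>_def)
  qed
qed

theorem theorem7p2:
  fixes \<Omega> :: "('n::finite) cvec set" and \<Phi> :: "'n cvec \<Rightarrow> 'n cvec" and U :: "'n cvec set"
  assumes "is_domain \<Omega>" and "bounded \<Omega>" and "prop1 \<Omega>" and "prop2 \<Omega>"
    and "open U" and "closure \<Omega> \<subseteq> U" and "holo_map_on U \<Phi>"
    and "interior (\<Phi> ` \<Omega>) \<noteq> {}"
    and "\<epsilon> > 0"
  shows "\<exists>\<Omega>'. is_domain \<Omega>' \<and> prop1 \<Omega>' \<and> prop2 \<Omega>' \<and>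
           (\<Omega>' - \<Omega>) \<union> (\<Omega> - \<Omega>') \<subseteq> nbhd (frontier \<Omega>) \<epsilon> \<and>
           closure \<Omega>' \<subseteq> U \<and> Vstar_trivial \<Phi> \<Omega>'"
proof -
  obtain D W where D: "is_domain D" "bounded D" "prop1 D" "prop2 D" "\<Omega> \<subseteq> D"
      "D - \<Omega> \<subseteq> nbhd (frontier \<Omega>) \<epsilon>" "closure D \<subseteq> U"
    and W: "open W" "W \<noteq> {}" "W \<subseteq> D" "inj_on \<Phi> W"
      "\<And>z w. z \<in> D \<Longrightarrow> w \<in> W \<Longrightarrow> \<Phi> z = \<Phi> w \<Longrightarrow> z \<in> W"
    by (rule separated_enlargement[OF assms(1-3,5-9)]) (rule that)
  have hol: "holo_map_on D \<Phi>"
    using assms(7) D(7) closure_subset[of D] by (auto simp: holo_map_on_def intro: holo_on_subset)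
  have bdd: "bounded (\<Phi> ` D)"
  proof (rule bounded_subset)
    have "compact (\<Phi> ` closure D)"
      using D(2,7) by (intro compact_continuous_image continuous_on_subset[OF holo_map_continuous_on[OF assms(7)]]) auto
    then show "bounded (\<Phi> ` closure D)" by (rule compact_imp_bounded)
    show "\<Phi> ` D \<subseteq> \<Phi> ` closure D" using closure_subset by blast
  qed
  have "Vstar_trivial \<Phi> D"
    by (rule Vstar_trivial_of_separated[OF D(1,2) hol bdd W(1-4)]) (rule W(5))
  \<comment> \<open>Since \<open>\<Omega> \<subseteq> D\<close>, one half of the symmetric
    difference is empty.\<close>
  moreover have "(D - \<Omega>) \<union> (\<Omega> - D) \<subseteq> nbhd (frontier \<Omega>) \<epsilon>" using D(5,6) by blast
  ultimately show ?thesis using D by blast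
qed

end
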